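(* Let $D$ be an even delta-matroid and let $T(D;x,y)$ be its Tutte polynomial. Then $T(D;x,y)$ is irreducible over $\mathbb{Z}[x,y]$ if and only if $D$ is connected. The same equivalence holds with $\mathbb{Z}[x,y]$ replaced by $\mathbb{C}[x,y]$.
   Context: A delta-matroid is a pair $D=(E,\mathcal{F})$ where $E$ is a finite set (the ground set) and $\mathcal{F}$ is a non-empty collection of subsets of $E$ (the feasible sets) such that for all $F_1,F_2\in\mathcal{F}$ and $e\in F_1\bigtriangleup F_2$ there is $f\in F_1\bigtriangleup F_2$ (possibly $f=e$) with $F_1\bigtriangleup\{e,f\}\in\mathcal{F}$. It is even if all feasible sets have cardinalities of the same parity. The feasible sets of maximum (respectively minimum) size are the bases of a matroid on $E$, denoted $D_{\max}$ (respectively $D_{\min}$); $r(M)$ denotes the rank of a matroid $M$. An element is a coloop of $D$ if it belongs to every feasible set and a loop if it belongs to none. If $e$ is not a coloop, $D\backslash e=(E-e,\{F\in\mathcal{F}: e\notin F\})$; if $e$ is not a loop, $D/e=(E-e,\{F-e: F\in\mathcal{F}, e\in F\})$; if $e$ is a loop or a coloop, whichever of $D\backslash e$, $D/e$ is not yet defined is set equal to the other. Sets of elements may be deleted one element at a time, the order being irrelevant. For $A\subseteq E$, $D|A=D\backslash(E\setminus A)$ and $\sigma(A)=\tfrac12\big(r((D|A)_{\max})+r((D|A)_{\min})\big)$ (an integer when $D$ is even). The Tutte polynomial of $D$ is $$T(D;x,y)=\sum_{A\subseteq E}(x-1)^{\sigma(E)-\sigma(A)}(y-1)^{|A|-\sigma(A)}.$$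 For $D_1=(E_1,\mathcal{F}_1)$, $D_2=(E_2,\mathcal{F}_2)$ with $E_1\cap E_2=\emptyset$, $D_1\oplus D_2=(E_1\cup E_2,\{F_1\cup F_2: F_1\in\mathcal{F}_1,F_2\in\mathcal{F}_2\})$. $D$ is connected if there do not exist delta-matroids $D_1,D_2$ with non-empty ground sets such that $D=D_1\oplus D_2$. Convention: a polynomial is called irreducible over a ring if it has no non-trivial factorization, i.e. it is not a product of two non-unit polynomials over that ring; in particular the constant polynomial $1$ (which arises when $E=\emptyset$) counts as irreducible. *)

theory Defs
  imports Complex_Main "HOL-Computational_Algebra.Polynomial"
begin

type_synonym 'a set_system = "'a set \<times> 'a set set"

abbreviation ground :: "'a set_system \<Rightarrow> 'a set" where
  "ground \<equiv> fst"

abbreviation feasible :: "'a set_system \<Rightarrow> 'a set set" where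
  "feasible \<equiv> snd"

definition delta_matroid :: "'a set_system \<Rightarrow> bool" where
  "delta_matroid D \<longleftrightarrow>
     finite (ground D) \<and> feasible D \<noteq> {} \<and> feasible D \<subseteq> Pow (ground D) \<and>
     (\<forall>F1\<in>feasible D. \<forall>F2\<in>feasible D. \<forall>e\<in>sym_diff F1 F2.
        \<exists>f\<in>sym_diff F1 F2. sym_diff F1 {e, f} \<in> feasible D)"

definition even_dm :: "'a set_system \<Rightarrow> bool" where
  "even_dm D \<longleftrightarrow>
     (\<forall>F1\<in>feasible D. \<forall>F2\<in>feasible D. even (card F1) \<longleftrightarrow> even (card F2))"

(* The matroids D_max and D_min are given by their ground set and their family of bases. *)

definition dm_max :: "'a set_system \<Rightarrow> 'a set_system" where
  "dm_max D = (ground D, {F \<in> feasible D. \<forall>F'\<in>feasible D. card F' \<le> card F})"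

definition dm_min :: "'a set_system \<Rightarrow> 'a set_system" where
  "dm_min D = (ground D, {F \<in> feasible D. \<forall>F'\<in>feasible D. card F \<le> card F'})"

(* The common cardinality of the bases of a matroid (E, bases). *)
definition matroid_rank :: "'a set_system \<Rightarrow> nat" where
  "matroid_rank M = (THE k. card ` snd M = {k})"

definition dm_coloop :: "'a set_system \<Rightarrow> 'a \<Rightarrow> bool" where
  "dm_coloop D e \<longleftrightarrow> e \<in> ground D \<and> (\<forall>F\<in>feasible D. e \<in> F)"

definition dm_loop :: "'a set_system \<Rightarrow> 'a \<Rightarrow> bool" where
  "dm_loop D e \<longleftrightarrow> e \<in> ground D \<and> (\<forall>F\<in>feasible D. e \<notin> F)"

(* If e is a loop, D/e is set equal to D\e; the first branch is D\e for a non-coloop e. *)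
definition dm_contract :: "'a set_system \<Rightarrow> 'a \<Rightarrow> 'a set_system" where
  "dm_contract D e =
     (if dm_loop D e then (ground D - {e}, {F \<in> feasible D. e \<notin> F})
      else (ground D - {e}, {F - {e} | F. F \<in> feasible D \<and> e \<in> F}))"

definition dm_delete :: "'a set_system \<Rightarrow> 'a \<Rightarrow> 'a set_system" where
  "dm_delete D e =
     (if dm_coloop D e then dm_contract D e
      else (ground D - {e}, {F \<in> feasible D. e \<notin> F}))"

(* The elements of the finite set A are deleted one at a time, in an arbitrarily chosen order;
   for a delta-matroid D and A contained in its ground set the result does not depend on it. *)
definition dm_delete_set :: "'a set_system \<Rightarrow> 'a set \<Rightarrow> 'a set_system" where
  "dm_delete_set D A = foldl dm_delete D (SOME es. distinct es \<and> set es = A)"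

definition dm_restrict :: "'a set_system \<Rightarrow> 'a set \<Rightarrow> 'a set_system" where
  "dm_restrict D A = dm_delete_set D (ground D - A)"

(* For an even delta-matroid D the sum of the two ranks is even, so the division is exact. *)
definition dm_sigma :: "'a set_system \<Rightarrow> 'a set \<Rightarrow> nat" where
  "dm_sigma D A =
     (matroid_rank (dm_max (dm_restrict D A)) + matroid_rank (dm_min (dm_restrict D A))) div 2"

(* R[x,y] is represented as R[x][y]. *)

definition var_x :: "'r::comm_ring_1 poly poly" where
  "var_x = [:[:0, 1:]:]"

definition var_y :: "'r::comm_ring_1 poly poly" where
  "var_y = [:0, 1:]"

(* The defining formula read in R[x,y]; the polynomial over R is the image of the one over the
   integers. For an even delta-matroid D and A contained in its ground set, dm_sigma D A is at
   most dm_sigma D (ground D) and at most card A, so the natural-number subtractions in the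
   exponents are not truncated. *)
definition tutte_poly :: "'a set_system \<Rightarrow> 'r::comm_ring_1 poly poly" where
  "tutte_poly D =
     (\<Sum>A\<in>Pow (ground D).
        (var_x - 1) ^ (dm_sigma D (ground D) - dm_sigma D A) *
        (var_y - 1) ^ (card A - dm_sigma D A))"

(* Meaningful for disjoint ground sets only. *)
definition dm_direct_sum :: "'a set_system \<Rightarrow> 'a set_system \<Rightarrow> 'a set_system" where
  "dm_direct_sum D1 D2 =
     (ground D1 \<union> ground D2, {F1 \<union> F2 | F1 F2. F1 \<in> feasible D1 \<and> F2 \<in> feasible D2})"

definition dm_connected :: "'a set_system \<Rightarrow> bool" where
  "dm_connected D \<longleftrightarrow>
     \<not> (\<exists>D1 D2. delta_matroid D1 \<and> delta_matroid D2 \<and> ground D1 \<noteq> {} \<and> ground D2 \<noteq> {} \<and>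
          ground D1 \<inter> ground D2 = {} \<and> D = dm_direct_sum D1 D2)"

(* Unlike the library constant irreducible, this counts units (in particular the Tutte
   polynomial 1 of a delta-matroid with empty ground set) as irreducible. *)
definition no_nontrivial_factorization :: "'r::comm_semiring_1 \<Rightarrow> bool" where
  "no_nontrivial_factorization p \<longleftrightarrow>
     \<not> (\<exists>a b. \<not> a dvd 1 \<and> \<not> b dvd 1 \<and> p = a * b)"

end

theory Submission
  imports Defs
begin

text \<open>
  Put d(A) for the least size of the symmetric difference of A and F over feasible F. Deleting an
  element changes d only by a constant, so 2 \<sigma>(A) = |A| + d({}) - d(A). On the hyperbola (x - 1)(y - 1) = 1 every summand of T depends
  on |A| only and T becomes x^n (x - 1)^(\<sigma>(E) - n) with n = |E|. If T = a b and b(0, 0) is nonzero,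
  the whole zero x^n comes from a, which forces a to have the full degree of T in x and in y; hence b is
  a constant, and a unit.

  The linear coefficient of T(z, z) is, up to sign, beta(D), the sum of (-1)^(d(A)+1) d(A) over all A;
  if it is nonzero then a and b do not both vanish at (0, 0). It is invariant under twisting and additive
  under deletion and contraction. Twist D so that the empty set is feasible, and join u and v when {u, v}
  is feasible. If this graph is connected then, for each e, it stays connected after deleting e or after
  pivoting on some edge e f and then deleting e, so that beta(D) > 0 by induction. If it is
  disconnected, D is a direct sum.
\<close>

section \<open>Symmetric differences and the distance to the feasible sets\<close>

lemma even_card_sym_diff:
  assumes "finite A" "finite B"
  shows "even (card (sym_diff A B)) \<longleftrightarrow> even (card A + card B)"
proof -
  have "card (sym_diff A B) = card (A - B) + card (B - A)"
    using assms by (intro card_Un_disjoint) auto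
  moreover have "card A = card (A - B) + card (A \<inter> B)" "card B = card (B - A) + card (A \<inter> B)"
    using assms card_Diff_subset_Int[of A B] card_Diff_subset_Int[of B A]
    by (auto simp: Int_commute card_mono)
  ultimately show ?thesis by presburger
qed

lemma card_sym_diff_triangle:
  assumes "finite A" "finite B" "finite C"
  shows "card (sym_diff A C) \<le> card (sym_diff A B) + card (sym_diff B C)"
proof -
  have "card (sym_diff A C) \<le> card (sym_diff A B \<union> sym_diff B C)"
    using assms by (intro card_mono) auto
  then show ?thesis using card_Un_le le_trans by blast
qed

lemma delta_matroidD:
  assumes "delta_matroid D"
  shows finite_ground: "finite (ground D)"
    and feasible_nonempty: "feasible D \<noteq> {}"
    and feasible_subset: "F \<in> feasible D \<Longrightarrow> F \<subseteq> ground D"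
    and finite_feasible: "F \<in> feasible D \<Longrightarrow> finite F"
    and finite_subset_ground: "A \<subseteq> ground D \<Longrightarrow> finite A"
  using assms unfolding delta_matroid_def by (auto intro: rev_finite_subset)

text \<open>The function d of the overview, a Hamming distance. As an infimum of naturals it is
  attained once the family is non-empty.\<close>

definition fdist :: "'a set set \<Rightarrow> 'a set \<Rightarrow> nat" where
  "fdist \<F> A = (INF F\<in>\<F>. card (sym_diff A F))"

lemma fdist_le: "F \<in> \<F> \<Longrightarrow> fdist \<F> A \<le> card (sym_diff A F)"
  unfolding fdist_def by (intro cINF_lower) auto

lemma fdist_attained:
  assumes "\<F> \<noteq> {}"
  obtains F where "F \<in> \<F>" "card (sym_diff A F) = fdist \<F> A"
proof -
  have "fdist \<F> A \<in> (\<lambda>F. card (sym_diff A F)) ` \<F>"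
    unfolding fdist_def using assms by (intro Inf_nat_def1) auto
  then show ?thesis using that by auto
qed

lemma fdist_eqI:
  assumes "F \<in> \<F>" "card (sym_diff A F) = k" "\<And>F'. F' \<in> \<F> \<Longrightarrow> k \<le> card (sym_diff A F')"
  shows "fdist \<F> A = k"
  using assms fdist_le[of F \<F> A] fdist_attained[of \<F> A] by (metis empty_iff le_antisym)

text \<open>The triangle inequality through a feasible set nearest to \<open>B\<close>. It later
  controls the exponents and degrees of the Tutte polynomial.\<close>

lemma fdist_lipschitz:
  assumes "delta_matroid D" "A \<subseteq> ground D" "B \<subseteq> ground D"
  shows "fdist (feasible D) A \<le> fdist (feasible D) B + card (sym_diff A B)"
proof -
  obtain F where F: "F \<in> feasible D" "card (sym_diff B F) = fdist (feasible D) B"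
    using fdist_attained feasible_nonempty[OF assms(1)] by blast
  have "card (sym_diff A F) \<le> card (sym_diff A B) + card (sym_diff B F)"
    using delta_matroidD[OF assms(1)] assms F by (intro card_sym_diff_triangle) auto
  then show ?thesis using fdist_le[OF F(1), of A] F(2) by linarith
qed

text \<open>Evenness excludes \<open>f = e\<close>, since toggling a single element changes the
  parity of the size.\<close>

lemma exchange:
  assumes "delta_matroid D" "even_dm D" "F1 \<in> feasible D" "F2 \<in> feasible D" "e \<in> sym_diff F1 F2"
  obtains f where "f \<in> sym_diff F1 F2" "f \<noteq> e" "sym_diff F1 {e, f} \<in> feasible D"
proof -
  obtain f where f: "f \<in> sym_diff F1 F2" "sym_diff F1 {e, f} \<in> feasible D"
    using assms unfolding delta_matroid_def by blast
  have "finite F1" using assms(1,3) by (rule finite_feasible)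
  then have "even (card (sym_diff F1 {e})) \<longleftrightarrow> \<not> even (card F1)"
    using even_card_sym_diff[of F1 "{e}"] by simp
  then have "sym_diff F1 {e} \<notin> feasible D" using assms(2,3) unfolding even_dm_def by blast
  then have "f \<noteq> e" using f(2) by (metis insert_absorb2)
  then show ?thesis using f that by blast
qed

lemma even_fdist:
  assumes "delta_matroid D" "even_dm D" "F \<in> feasible D" "A \<subseteq> ground D"
  shows "even (fdist (feasible D) A) \<longleftrightarrow> even (card A + card F)"
proof -
  obtain F' where F': "F' \<in> feasible D" "card (sym_diff A F') = fdist (feasible D) A"
    using fdist_attained assms(3) by blast
  have "finite A" "finite F'"
    using assms F' delta_matroidD[OF assms(1)] by auto
  then have "even (fdist (feasible D) A) \<longleftrightarrow> even (card A + card F')"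
    using even_card_sym_diff[of A F'] F'(2) by simp
  moreover have "even (card F') \<longleftrightarrow> even (card F)"
    using F'(1) assms(2,3) unfolding even_dm_def by blast
  ultimately show ?thesis by simp
qed

section \<open>Deletion\<close>

text \<open>This is deletion of \<open>e\<close> unless \<open>e\<close> is a coloop. Applied to the
  twist by \<open>{e}\<close> it is contraction of \<open>e\<close> unless \<open>e\<close> is a
  loop.\<close>

abbreviation avoiding :: "'a set_system \<Rightarrow> 'a \<Rightarrow> 'a set_system" where
  "avoiding D e \<equiv> (ground D - {e}, {F \<in> feasible D. e \<notin> F})"

lemma delta_matroid_avoid:
  assumes "delta_matroid D" "F0 \<in> feasible D" "e \<notin> F0"
  shows "delta_matroid (avoiding D e)"
  unfolding delta_matroid_def
proof (intro conjI ballI)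
  show "finite (ground (avoiding D e))"
    using assms(1) by (simp add: delta_matroid_def)
  show "feasible (avoiding D e) \<noteq> {}" using assms(2,3) by auto
  show "feasible (avoiding D e) \<subseteq> Pow (ground (avoiding D e))"
    using assms(1) by (auto simp: delta_matroid_def)
next
  fix F1 F2 x
  assume "F1 \<in> feasible (avoiding D e)"
    "F2 \<in> feasible (avoiding D e)" and x: "x \<in> sym_diff F1 F2"
  then have F: "F1 \<in> feasible D" "F2 \<in> feasible D" "e \<notin> F1" "e \<notin> F2" by auto
  then obtain f where "f \<in> sym_diff F1 F2" "sym_diff F1 {x, f} \<in> feasible D"
    using assms(1) x unfolding delta_matroid_def by blast
  then show "\<exists>f\<in>sym_diff F1 F2. sym_diff F1 {x, f} \<in> feasible (avoiding D e)"
    using F x by (intro bexI[of _ f]) auto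
qed

lemma even_dm_avoid:
  "even_dm D \<Longrightarrow> even_dm (E, {F \<in> feasible D. e \<notin> F})"
  unfolding even_dm_def by auto

text \<open>A nearest feasible set containing \<open>e\<close> can be traded for an equally near one
  without \<open>e\<close>: dropping \<open>e\<close> gains one, as \<open>e\<close> is not in
  \<open>A\<close>, and the partner in an exchange towards \<open>F0\<close> costs at most
  one.\<close>

lemma fdist_avoid:
  assumes "delta_matroid D" "F0 \<in> feasible D" "e \<notin> F0" "A \<subseteq> ground D" "e \<notin> A"
  shows "fdist {F \<in> feasible D. e \<notin> F} A = fdist (feasible D) A"
proof -
  note fin = finite_feasible[OF assms(1)]
  have finA: "finite A" using assms(1,4) by (rule finite_subset_ground)
  have "\<exists>F\<in>feasible D. e \<notin> F \<and> card (sym_diff A F) = fdist (feasible D) A"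
  proof -
    obtain F1 where F1: "F1 \<in> feasible D" "card (sym_diff A F1) = fdist (feasible D) A"
      using fdist_attained assms(2) by blast
    show ?thesis
    proof (cases "e \<in> F1")
      case True
      then obtain f where f: "f \<in> sym_diff F1 F0" "sym_diff F1 {e, f} \<in> feasible D"
        using assms(1-3) F1(1) unfolding delta_matroid_def by (metis DiffI UnI1)
      have eq: "sym_diff A F1 = insert e (sym_diff A (F1 - {e}))" using True assms(5) by auto
      have c: "card (sym_diff A F1) = Suc (card (sym_diff A (F1 - {e})))"
        unfolding eq using finA fin[OF F1(1)] assms(5) by (subst card_insert_disjoint) auto
      \<comment> \<open>With \<open>f = e\<close> the set \<open>F1 - {e}\<close> would be feasible
        and strictly nearer to \<open>A\<close> than the nearest set \<open>F1\<close>.\<close>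
      have "f \<noteq> e"
      proof
        assume "f = e"
        then have "sym_diff F1 {e, f} = F1 - {e}" using True by auto
        then show False using fdist_le[OF f(2), of A] c F1(2) by simp
      qed
      then have "e \<notin> sym_diff F1 {e, f}" using True by auto
      moreover have "card (sym_diff A (sym_diff F1 {e, f})) \<le> card (insert f (sym_diff A (F1 - {e})))"
        using finA fin[OF F1(1)] True by (intro card_mono) auto
      then have "card (sym_diff A (sym_diff F1 {e, f})) \<le> card (sym_diff A F1)"
        using c finA fin[OF F1(1)] card_insert_le_m1[of "Suc (card (sym_diff A (F1 - {e})))" "sym_diff A (F1 - {e})" f]
        by linarith
      ultimately show ?thesis using f(2) F1(2) fdist_le[OF f(2), of A] by (metis le_antisym)
    qed (use F1 in blast)
  qed
  then show ?thesis by (metis (mono_tags, lifting) fdist_eqI fdist_le mem_Collect_eq)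
qed

lemma fdist_remove_coloop:
  assumes "delta_matroid D" "\<And>F. F \<in> feasible D \<Longrightarrow> e \<in> F" "A \<subseteq> ground D" "e \<notin> A"
  shows "fdist (feasible D) A = Suc (fdist {F - {e} |F. F \<in> feasible D \<and> e \<in> F} A)"
proof -
  have card: "card (sym_diff A F) = Suc (card (sym_diff A (F - {e})))" if "F \<in> feasible D" for F
  proof -
    have "sym_diff A F = insert e (sym_diff A (F - {e}))" using assms(2)[OF that] assms(4) by auto
    moreover have "finite A" "finite F"
      using assms(3) that delta_matroidD[OF assms(1)] by auto
    ultimately show ?thesis using assms(4) by (metis (no_types, lifting) DiffE Diff_iff UnE card_insert_disjoint finite_Diff finite_UnI insertI1)
  qed
  obtain F where F: "F \<in> feasible D" "card (sym_diff A F) = fdist (feasible D) A"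
    using fdist_attained feasible_nonempty[OF assms(1)] by blast
  have "fdist {F - {e} |F. F \<in> feasible D \<and> e \<in> F} A = fdist (feasible D) A - 1"
  proof (rule fdist_eqI)
    show "F - {e} \<in> {F - {e} |F. F \<in> feasible D \<and> e \<in> F}" using F assms(2) by blast
    show "card (sym_diff A (F - {e})) = fdist (feasible D) A - 1" using F card[OF F(1)] by simp
    fix F' assume "F' \<in> {F - {e} |F. F \<in> feasible D \<and> e \<in> F}"
    then show "fdist (feasible D) A - 1 \<le> card (sym_diff A F')"
      using card fdist_le[of _ "feasible D" A] by fastforce
  qed
  then show ?thesis using F card[OF F(1)] by simp
qed

lemma delta_matroid_remove_coloop:
  assumes "delta_matroid D" "\<And>F. F \<in> feasible D \<Longrightarrow> e \<in> F"
  shows "delta_matroid (ground D - {e}, {F - {e} |F. F \<in> feasible D \<and> e \<in> F})"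
  unfolding delta_matroid_def
proof (intro conjI ballI)
  let ?D = "(ground D - {e}, {F - {e} |F. F \<in> feasible D \<and> e \<in> F})"
  show "finite (ground ?D)" "feasible ?D \<noteq> {}" "feasible ?D \<subseteq> Pow (ground ?D)"
    using assms by (auto simp: delta_matroid_def)
  fix F1 F2 x
  assume "F1 \<in> feasible ?D" "F2 \<in> feasible ?D" and x: "x \<in> sym_diff F1 F2"
  then obtain G1 G2 where G: "G1 \<in> feasible D" "G2 \<in> feasible D" "F1 = G1 - {e}" "F2 = G2 - {e}"
    by auto
  then obtain f where f: "f \<in> sym_diff G1 G2" "sym_diff G1 {x, f} \<in> feasible D"
    using assms(1) x unfolding delta_matroid_def by blast
  have "e \<in> G1" "e \<in> G2" "e \<in> sym_diff G1 {x, f}" using G f assms(2) by blast+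
  then show "\<exists>f\<in>sym_diff F1 F2. sym_diff F1 {x, f} \<in> feasible ?D"
    using G x f by (intro bexI[of _ f]) (auto intro!: exI[of _ "sym_diff G1 {x, f}"])
qed

text \<open>The constant is 1 for a coloop, which lies in every feasible set but not in
  \<open>A\<close>, and 0 otherwise. Its value is left open because it will cancel in differences of
  distances.\<close>

lemma dm_delete_facts:
  assumes "delta_matroid D" "e \<in> ground D"
  shows "delta_matroid (dm_delete D e)" "ground (dm_delete D e) = ground D - {e}"
    "\<exists>c. \<forall>A. A \<subseteq> ground D - {e} \<longrightarrow> fdist (feasible D) A = fdist (feasible (dm_delete D e)) A + c"
proof -
  have "delta_matroid (dm_delete D e) \<and> ground (dm_delete D e) = ground D - {e} \<and>
    (\<exists>c. \<forall>A. A \<subseteq> ground D - {e} \<longrightarrow> fdist (feasible D) A = fdist (feasible (dm_delete D e)) A + c)"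
  proof (cases "dm_coloop D e")
    case True
    then have all: "\<And>F. F \<in> feasible D \<Longrightarrow> e \<in> F" by (simp add: dm_coloop_def)
    moreover from this have "\<not> dm_loop D e"
      using feasible_nonempty[OF assms(1)] unfolding dm_loop_def by blast
    ultimately have eq: "dm_delete D e = (ground D - {e}, {F - {e} |F. F \<in> feasible D \<and> e \<in> F})"
      using True by (simp add: dm_delete_def dm_contract_def)
    have "\<forall>A. A \<subseteq> ground D - {e} \<longrightarrow> fdist (feasible D) A = fdist (feasible (dm_delete D e)) A + 1"
      using fdist_remove_coloop[OF assms(1) all] unfolding eq by auto
    then show ?thesis
      using delta_matroid_remove_coloop[OF assms(1) all] unfolding eq by auto
  next
    case False
    then obtain F0 where F0: "F0 \<in> feasible D" "e \<notin> F0" using assms(2) by (auto simp: dm_coloop_def)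
    have eq: "dm_delete D e = avoiding D e"
      using False by (simp add: dm_delete_def)
    have "\<forall>A. A \<subseteq> ground D - {e} \<longrightarrow> fdist (feasible D) A = fdist (feasible (dm_delete D e)) A + 0"
      unfolding eq using fdist_avoid[OF assms(1) F0] by (simp add: subset_Diff_insert)
    then show ?thesis
      using delta_matroid_avoid[OF assms(1) F0] unfolding eq by auto
  qed
  then show "delta_matroid (dm_delete D e)" "ground (dm_delete D e) = ground D - {e}"
    "\<exists>c. \<forall>A. A \<subseteq> ground D - {e} \<longrightarrow> fdist (feasible D) A = fdist (feasible (dm_delete D e)) A + c"
    by blast+
qed

lemma foldl_dm_delete:
  assumes "delta_matroid D" "distinct es" "set es \<subseteq> ground D"
  shows "delta_matroid (foldl dm_delete D es) \<and> ground (foldl dm_delete D es) = ground D - set es \<and>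
    (\<exists>c. \<forall>A. A \<subseteq> ground D - set es \<longrightarrow>
       fdist (feasible D) A = fdist (feasible (foldl dm_delete D es)) A + c)"
  using assms
proof (induction es arbitrary: D)
  case (Cons e es)
  let ?D = "dm_delete D e"
  have e: "e \<in> ground D" using Cons by auto
  obtain c where c: "\<And>A. A \<subseteq> ground D - {e} \<Longrightarrow> fdist (feasible D) A = fdist (feasible ?D) A + c"
    using dm_delete_facts(3)[OF Cons.prems(1) e] by blast
  have IH: "delta_matroid (foldl dm_delete ?D es)" "ground (foldl dm_delete ?D es) = ground ?D - set es"
    "\<exists>c. \<forall>A. A \<subseteq> ground ?D - set es \<longrightarrow>
       fdist (feasible ?D) A = fdist (feasible (foldl dm_delete ?D es)) A + c"
    using Cons.IH[of ?D] Cons.prems dm_delete_facts(1,2)[OF Cons.prems(1) e] by auto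
  obtain c' where c': "\<And>A. A \<subseteq> ground ?D - set es \<Longrightarrow>
       fdist (feasible ?D) A = fdist (feasible (foldl dm_delete ?D es)) A + c'" using IH(3) by blast
  have gr: "ground D - set (e # es) = ground ?D - set es"
    using dm_delete_facts(2)[OF Cons.prems(1) e] by auto
  have "fdist (feasible D) A = fdist (feasible (foldl dm_delete ?D es)) A + (c' + c)"
    if "A \<subseteq> ground D - set (e # es)" for A
    using c[of A] c'[of A] that unfolding gr dm_delete_facts(2)[OF Cons.prems(1) e] by fastforce
  then show ?case unfolding foldl_Cons using IH(1,2) gr by metis
qed auto

lemma dm_restrict_facts:
  assumes "delta_matroid D" "A \<subseteq> ground D"
  shows "delta_matroid (dm_restrict D A) \<and> ground (dm_restrict D A) = A \<and>
    (\<exists>c. \<forall>B. B \<subseteq> A \<longrightarrow> fdist (feasible D) B = fdist (feasible (dm_restrict D A)) B + c)"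
proof -
  \<comment> \<open>The order hidden in \<open>SOME\<close> is harmless:
    \<open>foldl_dm_delete\<close> applies to every distinct enumeration of the complement.\<close>
  define es where "es = (SOME es. distinct es \<and> set es = ground D - A)"
  have "finite (ground D - A)" using finite_ground[OF assms(1)] by blast
  then have "\<exists>es. distinct es \<and> set es = ground D - A"
    using finite_distinct_list by blast
  then have "distinct es \<and> set es = ground D - A" unfolding es_def by (rule someI_ex)
  then have es: "distinct es" "set es = ground D - A" "set es \<subseteq> ground D" by blast+
  have A: "ground D - set es = A" using assms(2) es(2) by blast
  have "dm_restrict D A = foldl dm_delete D es"
    by (simp add: dm_restrict_def dm_delete_set_def es_def)
  then show ?thesis
    using foldl_dm_delete[OF assms(1) es(1,3)] unfolding A by simp
qed

section \<open>Ranks and \<sigma> in terms of distances\<close>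

lemma matroid_rank_dm_min:
  assumes "delta_matroid D"
  shows "matroid_rank (dm_min D) = fdist (feasible D) {}"
proof -
  obtain F where F: "F \<in> feasible D" "card (sym_diff {} F) = fdist (feasible D) {}"
    using fdist_attained feasible_nonempty[OF assms] by blast
  then have m: "card F = fdist (feasible D) {}" "\<And>F'. F' \<in> feasible D \<Longrightarrow> card F \<le> card F'"
    using fdist_le[of _ "feasible D" "{}"] by auto
  have "F \<in> snd (dm_min D)" using F(1) m(2) by (simp add: dm_min_def)
  moreover have "card F' = card F" if "F' \<in> snd (dm_min D)" for F'
    using that F(1) m(2) by (auto simp: dm_min_def intro: le_antisym)
  ultimately have "card ` snd (dm_min D) = {card F}" by blast
  then show ?thesis using m(1) by (simp add: matroid_rank_def)
qed

text \<open>A largest feasible set is one nearest to the whole ground set, because its distance from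
  there is the size of its complement.\<close>

lemma matroid_rank_dm_max:
  assumes "delta_matroid D"
  shows "matroid_rank (dm_max D) + fdist (feasible D) (ground D) = card (ground D)"
proof -
  have c: "card F + card (sym_diff (ground D) F) = card (ground D)" if "F \<in> feasible D" for F
  proof -
    have sub: "F \<subseteq> ground D" "finite (ground D)" using delta_matroidD[OF assms] that by auto
    then have "sym_diff (ground D) F = ground D - F" by auto
    then show ?thesis using sub by (simp add: card_Diff_subset card_mono finite_subset)
  qed
  obtain F where F: "F \<in> feasible D" "card (sym_diff (ground D) F) = fdist (feasible D) (ground D)"
    using fdist_attained feasible_nonempty[OF assms] by blast
  have m: "card F' \<le> card F" if "F' \<in> feasible D" for F'
    using fdist_le[OF that, of "ground D"] c[OF F(1)] c[OF that] F(2) by linarith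
  have "F \<in> snd (dm_max D)" using F(1) m by (simp add: dm_max_def)
  moreover have "card F' = card F" if "F' \<in> snd (dm_max D)" for F'
    using that F(1) m by (auto simp: dm_max_def intro: le_antisym)
  ultimately have "card ` snd (dm_max D) = {card F}" by blast
  then show ?thesis using c[OF F(1)] F(2) by (simp add: matroid_rank_def)
qed

text \<open>Let d' be the distance in the restriction to A. The two ranks there are |A| - d'(A) and
  d'({}), and d - d' is constant on the subsets of A, so their sum is |A| - d(A) + d({}).\<close>

lemma dm_sigma_fdist:
  assumes "delta_matroid D" "even_dm D" "A \<subseteq> ground D"
  shows "2 * dm_sigma D A + fdist (feasible D) A = card A + fdist (feasible D) {}"
proof -
  let ?D = "dm_restrict D A"
  obtain c where c: "\<And>B. B \<subseteq> A \<Longrightarrow> fdist (feasible D) B = fdist (feasible ?D) B + c"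
    and D: "delta_matroid ?D" "ground ?D = A"
    using dm_restrict_facts[OF assms(1,3)] by blast
  have eq: "matroid_rank (dm_max ?D) + matroid_rank (dm_min ?D) + fdist (feasible D) A
      = card A + fdist (feasible D) {}"
    using matroid_rank_dm_max[OF D(1)] matroid_rank_dm_min[OF D(1)] c[of A] c[of "{}"] D(2) by simp
  obtain F where "F \<in> feasible D" using feasible_nonempty[OF assms(1)] by blast
  \<comment> \<open>Parity makes the sum of the two ranks even, so that \<open>div 2\<close> in the
    definition of \<sigma> is exact.\<close>
  then have "even (fdist (feasible D) A) \<longleftrightarrow> even (card A + fdist (feasible D) {})"
    using even_fdist[OF assms(1,2)] assms(3) by auto
  then have "even (matroid_rank (dm_max ?D) + matroid_rank (dm_min ?D))"
    using eq by presburger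
  then show ?thesis using eq by (simp add: dm_sigma_def)
qed

section \<open>Twists\<close>

definition twist :: "'a set \<Rightarrow> 'a set_system \<Rightarrow> 'a set_system" where
  "twist X D = (ground D, (\<lambda>F. sym_diff F X) ` feasible D)"

lemma ground_twist [simp]: "ground (twist X D) = ground D"
  by (simp add: twist_def)

lemma sym_diff_cancel: "sym_diff (sym_diff A X) X = A"
  by blast

lemma mem_twist_iff: "F \<in> feasible (twist X D) \<longleftrightarrow> sym_diff F X \<in> feasible D"
proof
  assume "F \<in> feasible (twist X D)"
  then obtain G where "G \<in> feasible D" "F = sym_diff G X" by (auto simp: twist_def)
  then show "sym_diff F X \<in> feasible D" by (simp only: sym_diff_cancel)
next
  assume "sym_diff F X \<in> feasible D"
  then have "sym_diff (sym_diff F X) X \<in> feasible (twist X D)" unfolding twist_def by auto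
  then show "F \<in> feasible (twist X D)" by (simp only: sym_diff_cancel)
qed

text \<open>The symmetric difference of two sets is unchanged when both are twisted, so the exchange
  axiom carries over.\<close>

lemma delta_matroid_twist:
  assumes "delta_matroid D" "X \<subseteq> ground D"
  shows "delta_matroid (twist X D)"
  unfolding delta_matroid_def
proof (intro conjI ballI)
  show "finite (ground (twist X D))" using finite_ground[OF assms(1)] by simp
  show "feasible (twist X D) \<noteq> {}" using feasible_nonempty[OF assms(1)] by (simp add: twist_def)
  show "feasible (twist X D) \<subseteq> Pow (ground (twist X D))"
  proof
    fix F assume "F \<in> feasible (twist X D)"
    then have "sym_diff F X \<subseteq> ground D" using feasible_subset[OF assms(1)] mem_twist_iff by blast
    then show "F \<in> Pow (ground (twist X D))" using assms(2) by auto
  qed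
next
  fix F1 F2 e
  assume F: "F1 \<in> feasible (twist X D)" "F2 \<in> feasible (twist X D)" "e \<in> sym_diff F1 F2"
  have eq: "sym_diff (sym_diff F1 X) (sym_diff F2 X) = sym_diff F1 F2" by blast
  obtain f where f: "f \<in> sym_diff F1 F2" "sym_diff (sym_diff F1 X) {e, f} \<in> feasible D"
    using assms(1) F unfolding delta_matroid_def mem_twist_iff by (metis eq)
  have "sym_diff (sym_diff F1 X) {e, f} = sym_diff (sym_diff F1 {e, f}) X" by blast
  then show "\<exists>f\<in>sym_diff F1 F2. sym_diff F1 {e, f} \<in> feasible (twist X D)"
    using f unfolding mem_twist_iff by metis
qed

lemma even_dm_twist:
  assumes "delta_matroid D" "even_dm D" "X \<subseteq> ground D"
  shows "even_dm (twist X D)"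
  unfolding even_dm_def
proof (intro ballI)
  have *: "even (card F) \<longleftrightarrow> even (card (sym_diff F X) + card X)" if "F \<in> feasible (twist X D)" for F
  proof -
    have "F \<subseteq> ground D" using feasible_subset[OF delta_matroid_twist[OF assms(1,3)] that] by simp
    then have "finite F" "finite X" using finite_subset_ground[OF assms(1)] assms(3) by auto
    then show ?thesis using even_card_sym_diff[of F X] by presburger
  qed
  fix F1 F2 assume F: "F1 \<in> feasible (twist X D)" "F2 \<in> feasible (twist X D)"
  then have "even (card (sym_diff F1 X)) \<longleftrightarrow> even (card (sym_diff F2 X))"
    using assms(2) unfolding mem_twist_iff even_dm_def by blast
  then show "even (card F1) \<longleftrightarrow> even (card F2)" using *[OF F(1)] *[OF F(2)] by simp
qed

lemma fdist_twist: "fdist (feasible (twist X D)) A = fdist (feasible D) (sym_diff A X)"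
proof -
  have "sym_diff A (sym_diff F X) = sym_diff (sym_diff A X) F" for F by blast
  then show ?thesis unfolding fdist_def twist_def by (simp only: snd_conv image_image)
qed

section \<open>The beta invariant\<close>

text \<open>For a matroid on at least two elements, with its bases as feasible sets, this is twice
  Crapo's beta invariant.\<close>

definition beta :: "'a set_system \<Rightarrow> int" where
  "beta D = (\<Sum>A\<in>Pow (ground D). (-1) ^ Suc (fdist (feasible D) A) * int (fdist (feasible D) A))"

lemma beta_twist:
  assumes "X \<subseteq> ground D"
  shows "beta (twist X D) = beta D"
  unfolding beta_def fdist_twist
  by (rule sum.reindex_bij_witness[where i = "\<lambda>A. sym_diff A X" and j = "\<lambda>A. sym_diff A X"])
    (use assms in auto)

lemma sum_Pow_split:
  fixes g :: "'a set \<Rightarrow> 'b::comm_monoid_add"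
  assumes "finite E" "e \<in> E"
  shows "sum g (Pow E) = (\<Sum>A\<in>Pow (E - {e}). g A + g (insert e A))"
proof -
  have "Pow E = Pow (E - {e}) \<union> insert e ` Pow (E - {e})"
    using Pow_insert[of e "E - {e}"] assms(2) by (simp add: insert_absorb)
  then have "sum g (Pow E) = sum g (Pow (E - {e})) + sum g (insert e ` Pow (E - {e}))"
    using assms(1) by (simp add: sum.union_disjoint) (intro sum.union_disjoint, auto)
  also have "sum g (insert e ` Pow (E - {e})) = (\<Sum>A\<in>Pow (E - {e}). g (insert e A))"
    by (subst sum.reindex) (auto intro!: inj_onI)
  finally show ?thesis by (simp add: sum.distrib)
qed

lemma sum_Pow_alternating:
  assumes "finite E" "E \<noteq> {}"
  shows "(\<Sum>A\<in>Pow E. (-1) ^ card A) = (0 :: 'b::comm_ring_1)"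
proof -
  obtain e where e: "e \<in> E" using assms(2) by blast
  have "(-1) ^ card A + (-1) ^ card (insert e A) = (0 :: 'b)" if "A \<in> Pow (E - {e})" for A
  proof -
    have "finite A" "e \<notin> A" using that assms(1) by (auto intro: finite_subset)
    then show ?thesis by simp
  qed
  then show ?thesis unfolding sum_Pow_split[OF assms(1) e] by simp
qed

text \<open>By parity the signs are (-1)^|A| up to a global sign, and these cancel in pairs over the
  subsets of a non-empty set.\<close>

lemma sum_fdist_alternating:
  assumes "delta_matroid D" "even_dm D" "B \<subseteq> ground D" "B \<noteq> {}"
  shows "(\<Sum>A\<in>Pow B. (-1) ^ fdist (feasible D) A) = (0 :: 'b::comm_ring_1)"
proof -
  obtain F where F: "F \<in> feasible D" using feasible_nonempty[OF assms(1)] by blast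
  have "(-1) ^ fdist (feasible D) A = (-1) ^ card F * ((-1) ^ card A :: 'b)" if "A \<in> Pow B" for A
  proof -
    have "even (fdist (feasible D) A) \<longleftrightarrow> even (card F + card A)"
      using even_fdist[OF assms(1,2) F, of A] that assms(3) by (simp add: add.commute subset_trans)
    then show ?thesis by (metis minus_one_power_iff power_add)
  qed
  then have "(\<Sum>A\<in>Pow B. (-1) ^ fdist (feasible D) A) = (-1) ^ card F * (\<Sum>A\<in>Pow B. (-1) ^ card A :: 'b)"
    by (simp add: sum_distrib_left)
  then show ?thesis using sum_Pow_alternating[of B, where 'b = 'b] assms(3,4) finite_subset_ground[OF assms(1)] by simp
qed

lemma fdist_insert_loop:
  assumes "delta_matroid D" "\<And>F. F \<in> feasible D \<Longrightarrow> e \<notin> F" "A \<subseteq> ground D" "e \<notin> A"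
  shows "fdist (feasible D) (insert e A) = Suc (fdist (feasible D) A)"
proof -
  have card: "card (sym_diff (insert e A) F) = Suc (card (sym_diff A F))" if "F \<in> feasible D" for F
  proof -
    have eq: "sym_diff (insert e A) F = insert e (sym_diff A F)" using assms(2)[OF that] assms(4) by blast
    have "finite (sym_diff A F)" using assms(3) that delta_matroidD[OF assms(1)] by blast
    moreover have "e \<notin> sym_diff A F" using assms(2)[OF that] assms(4) by blast
    ultimately show ?thesis unfolding eq by (rule card_insert_disjoint)
  qed
  obtain F where F: "F \<in> feasible D" "card (sym_diff A F) = fdist (feasible D) A"
    using fdist_attained feasible_nonempty[OF assms(1)] by blast
  show ?thesis
  proof (rule fdist_eqI[OF F(1)])
    show "card (sym_diff (insert e A) F) = Suc (fdist (feasible D) A)" using card F by simp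
    show "Suc (fdist (feasible D) A) \<le> card (sym_diff (insert e A) F')" if "F' \<in> feasible D" for F'
      using card[OF that] fdist_le[OF that, of A] by simp
  qed
qed

text \<open>Pair A with its union with \<open>{e}\<close>. The distance grows by one, so the two
  terms add up to (-1)^(d(A)), whose sum over the subsets of E - e vanishes unless E - e is
  empty.\<close>

lemma beta_loop:
  assumes "delta_matroid D" "even_dm D" "e \<in> ground D" "\<And>F. F \<in> feasible D \<Longrightarrow> e \<notin> F"
  shows "beta D = (if ground D = {e} then 1 else 0)"
proof -
  have "beta D = (\<Sum>A\<in>Pow (ground D - {e}). (-1) ^ fdist (feasible D) A)"
    unfolding beta_def sum_Pow_split[OF finite_ground[OF assms(1)] assms(3)]
  proof (rule sum.cong[OF refl])
    fix A assume "A \<in> Pow (ground D - {e})"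
    then have "fdist (feasible D) (insert e A) = Suc (fdist (feasible D) A)"
      by (intro fdist_insert_loop[OF assms(1,4)]) auto
    then show "(-1) ^ Suc (fdist (feasible D) A) * int (fdist (feasible D) A)
        + (-1) ^ Suc (fdist (feasible D) (insert e A)) * int (fdist (feasible D) (insert e A))
        = (-1) ^ fdist (feasible D) A" by (simp add: algebra_simps)
  qed
  also have "\<dots> = (if ground D = {e} then 1 else 0)"
  proof (cases "ground D = {e}")
    case True
    obtain F where F: "F \<in> feasible D" using feasible_nonempty[OF assms(1)] by blast
    moreover have "F = {}" using True assms(4)[OF F] feasible_subset[OF assms(1) F] by auto
    ultimately have "fdist (feasible D) {} = 0" using fdist_le[of "{}" "feasible D" "{}"] by simp
    then show ?thesis using True by simp
  next
    case False
    then have "ground D - {e} \<noteq> {}" using assms(3) by blast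
    then show ?thesis using sum_fdist_alternating[OF assms(1,2), of "ground D - {e}"] False by auto
  qed
  finally show ?thesis .
qed

text \<open>Split the sum by membership of \<open>e\<close>. Sets without \<open>e\<close> keep
  their distance under deletion by \<open>fdist_avoid\<close>; the twist by \<open>{e}\<close>
  brings sets with \<open>e\<close> into the same situation. \<open>F0\<close> and \<open>F1\<close>
  witness that \<open>e\<close> is neither a coloop nor a loop.\<close>

lemma beta_deletion_contraction:
  assumes "delta_matroid D" "e \<in> ground D"
    and "F0 \<in> feasible D" "e \<notin> F0" "F1 \<in> feasible D" "e \<in> F1"
  shows "beta D = beta (avoiding D e) + beta (avoiding (twist {e} D) e)"
proof -
  have tw: "delta_matroid (twist {e} D)" using delta_matroid_twist[OF assms(1)] assms(2) by simp
  have F1': "sym_diff F1 {e} \<in> feasible (twist {e} D)" "e \<notin> sym_diff F1 {e}"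
    using assms(5,6) unfolding mem_twist_iff sym_diff_cancel by blast+
  have 1: "fdist (feasible (avoiding D e)) A = fdist (feasible D) A" if "A \<in> Pow (ground D - {e})" for A
    using fdist_avoid[OF assms(1,3,4), of A] that by (simp add: subset_Diff_insert)
  have 2: "fdist (feasible (avoiding (twist {e} D) e)) A = fdist (feasible D) (insert e A)"
    if "A \<in> Pow (ground D - {e})" for A
  proof -
    have eq: "sym_diff A {e} = insert e A" using that by blast
    have "fdist (feasible (twist {e} D)) A = fdist (feasible D) (insert e A)"
      unfolding fdist_twist eq ..
    then show ?thesis
      using fdist_avoid[OF tw F1', of A] that by (simp add: subset_Diff_insert)
  qed
  show ?thesis
    unfolding beta_def sum_Pow_split[OF finite_ground[OF assms(1)] assms(2)] sum.distrib
    using 1 2 by (intro arg_cong2[of _ _ _ _ "(+)"] sum.cong) auto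
qed

lemma beta_nonneg:
  assumes "delta_matroid D" "even_dm D"
  shows "beta D \<ge> 0"
  using assms
proof (induction "card (ground D)" arbitrary: D rule: less_induct)
  case less
  note D = less.prems
  show ?case
  proof (cases "ground D = {}")
    case True
    obtain F where "F \<in> feasible D" using feasible_nonempty[OF D(1)] by blast
    moreover from this have "F = {}" using True feasible_subset[OF D(1)] by blast
    ultimately have "fdist (feasible D) {} = 0" using fdist_le[of "{}" "feasible D" "{}"] by simp
    then show ?thesis unfolding beta_def True by simp
  next
    case False
    then obtain e where e: "e \<in> ground D" by blast
    then have sub: "{e} \<subseteq> ground D" by blast
    note tw = delta_matroid_twist[OF D(1) sub] even_dm_twist[OF D sub]
    have card: "card (ground D - {e}) < card (ground D)"
      using finite_ground[OF D(1)] e by (rule card_Diff1_less)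
    consider "\<And>F. F \<in> feasible D \<Longrightarrow> e \<notin> F" | "\<And>F. F \<in> feasible D \<Longrightarrow> e \<in> F"
      | F0 F1 where "F0 \<in> feasible D" "e \<notin> F0" "F1 \<in> feasible D" "e \<in> F1" by blast
    then show ?thesis
    proof cases
      case 1
      then show ?thesis using beta_loop[OF D e] by simp
    next
      case 2
      \<comment> \<open>A coloop of \<open>D\<close> is a loop of the twist by \<open>{e}\<close>,
        which has the same beta.\<close>
      have "e \<notin> F" if "F \<in> feasible (twist {e} D)" for F
        using 2 that unfolding mem_twist_iff by blast
      then have "beta (twist {e} D) \<ge> 0" using beta_loop[OF tw] e by simp
      then show ?thesis using beta_twist[OF sub] by simp
    next
      case 3
      have F1': "sym_diff F1 {e} \<in> feasible (twist {e} D)" "e \<notin> sym_diff F1 {e}"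
        using 3(3,4) unfolding mem_twist_iff sym_diff_cancel by blast+
      have "beta (avoiding D e) \<ge> 0"
        using card delta_matroid_avoid[OF D(1) 3(1,2)] even_dm_avoid[OF D(2)]
        by (intro less.hyps) auto
      moreover have "beta (avoiding (twist {e} D) e) \<ge> 0"
        using card delta_matroid_avoid[OF tw(1) F1'] even_dm_avoid[OF tw(2)]
        by (intro less.hyps) auto
      ultimately show ?thesis unfolding beta_deletion_contraction[OF D(1) e 3] by simp
    qed
  qed
qed

section \<open>Connectedness of the fundamental graph\<close>

text \<open>Connectedness is expressed by cuts instead of paths. The edges are the feasible pairs,
  as is natural when \<open>{}\<close> is feasible.\<close>

definition fundamental_graph_connected :: "'a set_system \<Rightarrow> bool" where
  "fundamental_graph_connected D \<longleftrightarrow>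
     (\<forall>V. V \<subseteq> ground D \<longrightarrow> V \<noteq> {} \<longrightarrow> V \<noteq> ground D \<longrightarrow>
        (\<exists>u\<in>V. \<exists>v\<in>ground D - V. {u, v} \<in> feasible D))"

text \<open>\<open>C\<close> witnesses that deleting \<open>e\<close> disconnects the graph. As the
  whole graph is connected, \<open>e\<close> has a neighbour \<open>f\<close> in \<open>C\<close>
  and a neighbour \<open>g\<close> on the other side; pivoting on \<open>e f\<close> creates links
  across the cut that survive the loss of \<open>e\<close>.\<close>

lemma pivot_connected:
  assumes D: "delta_matroid D" "even_dm D" and conn: "fundamental_graph_connected D"
    and e: "e \<in> ground D"
    and C: "C \<subseteq> ground D - {e}" "C \<noteq> {}" "C \<noteq> ground D - {e}"
    and cut: "\<And>u v. u \<in> C \<Longrightarrow> v \<in> ground D - {e} - C \<Longrightarrow> {u, v} \<notin> feasible D"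
  obtains f where "f \<in> ground D" "f \<noteq> e" "{e, f} \<in> feasible D"
    "fundamental_graph_connected (avoiding (twist {e, f} D) e)"
proof -
  have "C \<noteq> ground D" using C(1) e by blast
  then obtain f f' where f: "f \<in> C" "f' \<in> ground D - C" "{f, f'} \<in> feasible D"
    using conn C(1,2) unfolding fundamental_graph_connected_def by (metis Diff_subset subset_trans)
  then have "f' = e" using cut[of f f'] by blast
  with f have fe: "{f, e} \<in> feasible D" by simp
  let ?N = "ground D - {e} - C"
  have "?N \<subseteq> ground D" "?N \<noteq> {}" "?N \<noteq> ground D" using C e by blast+
  then obtain g g' where g: "g \<in> ?N" "g' \<in> ground D - ?N" "{g, g'} \<in> feasible D"
    using conn unfolding fundamental_graph_connected_def by metis
  then have "g' = e" using cut[of g' g] by (metis Diff_iff insert_commute singletonD)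
  with g have ge: "{g, e} \<in> feasible D" by simp
  \<comment> \<open>In the pivoted graph, \<open>u\<close> and \<open>v\<close> are adjacent when
    \<open>{u, v}\<close> toggled by \<open>{e, f}\<close> is feasible. Sets \<open>W\<close>
    without \<open>f\<close> suffice, since one side of each cut avoids \<open>f\<close>.\<close>
  have key: "\<exists>u\<in>W. \<exists>v\<in>ground D - {e} - W. sym_diff {u, v} {e, f} \<in> feasible D"
    if W: "W \<subseteq> ground D - {e, f}" "W \<noteq> {}" for W
  proof (rule ccontr)
    assume "\<not> ?thesis"
    then have H: "\<And>u v. u \<in> W \<Longrightarrow> v \<in> ground D - {e} - W \<Longrightarrow> sym_diff {u, v} {e, f} \<notin> feasible D"
      by blast
    have fE: "f \<in> ground D - {e} - W" "f \<noteq> e" using f(1) C(1) W(1) by blast+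
    \<comment> \<open>An old edge \<open>w e\<close> becomes a new edge \<open>w f\<close>, which
      would leave \<open>W\<close>. In particular \<open>g\<close>, an old neighbour of
      \<open>e\<close>, is outside \<open>W\<close>.\<close>
    have not_e: "{w, e} \<notin> feasible D" if "w \<in> W" for w
    proof -
      have "sym_diff {w, f} {e, f} = {w, e}" using that W(1) fE by blast
      then show ?thesis using H[OF that fE(1)] by simp
    qed
    have gE: "g \<in> ground D - {e} - W" "g \<noteq> f" "g \<noteq> e" using not_e[of g] ge g(1) f(1) by blast+
    have not_f: "{w, f} \<notin> feasible D" if w: "w \<in> W" for w
    proof
      assume wf: "{w, f} \<in> feasible D"
      have ne: "w \<noteq> e" "w \<noteq> f" "w \<noteq> g" using w W(1) gE by blast+
      have wC: "w \<in> C" using wf cut[OF f(1), of w] w W(1) by (metis Diff_iff insertCI insert_commute singletonD subsetD)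
      \<comment> \<open>Exchange at \<open>g\<close>: the partners \<open>w\<close> and
        \<open>f\<close> would give old edges across the cut, and the partner \<open>e\<close> a new
        edge from \<open>w\<close> to \<open>g\<close>, leaving \<open>W\<close>.\<close>
      have "g \<in> sym_diff {w, f} {g, e}" using ne gE by blast
      then obtain x where x: "x \<in> sym_diff {w, f} {g, e}" "x \<noteq> g" "sym_diff {w, f} {g, x} \<in> feasible D"
        using exchange[OF D wf ge] by blast
      then consider "x = w" | "x = f" | "x = e" by blast
      then show False
      proof cases
        case 1
        then have "sym_diff {w, f} {g, x} = {f, g}" using ne gE by blast
        then show False using x(3) cut[OF f(1) g(1)] by simp
      next
        case 2
        then have "sym_diff {w, f} {g, x} = {w, g}" using ne gE by blast
        then show False using x(3) cut[OF wC g(1)] by simp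
      next
        case 3
        then have "sym_diff {w, f} {g, x} = sym_diff {w, g} {e, f}" using ne gE fE by blast
        then show False using x(3) H[OF w gE(1)] by simp
      qed
    qed
    have "W \<subseteq> ground D" "W \<noteq> ground D" using W(1) e by blast+
    then obtain u v where uv: "u \<in> W" "v \<in> ground D - W" "{u, v} \<in> feasible D"
      using conn W(2) unfolding fundamental_graph_connected_def by metis
    have ne: "v \<noteq> e" "v \<noteq> f" "u \<noteq> e" "u \<noteq> f" "u \<noteq> v"
      using uv not_e[OF uv(1)] not_f[OF uv(1)] W(1) by blast+
    \<comment> \<open>Exchange at \<open>u\<close>: the partners \<open>e\<close> and
      \<open>f\<close> would give old edges from \<open>u\<close> to \<open>f\<close> and to
      \<open>e\<close>, both excluded above, and the partner \<open>v\<close> a new edge leaving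
      \<open>W\<close>.\<close>
    have "u \<in> sym_diff {f, e} {u, v}" using ne by blast
    then obtain x where x: "x \<in> sym_diff {f, e} {u, v}" "x \<noteq> u" "sym_diff {f, e} {u, x} \<in> feasible D"
      using exchange[OF D fe uv(3)] by blast
    then consider "x = e" | "x = f" | "x = v" by blast
    then show False
    proof cases
      case 1
      then have "sym_diff {f, e} {u, x} = {u, f}" using ne fE by blast
      then show False using x(3) not_f[OF uv(1)] by simp
    next
      case 2
      then have "sym_diff {f, e} {u, x} = {u, e}" using ne fE by blast
      then show False using x(3) not_e[OF uv(1)] by simp
    next
      case 3
      then have "sym_diff {f, e} {u, x} = sym_diff {u, v} {e, f}" using ne fE by blast
      then show False using x(3) H[OF uv(1), of v] uv(2) ne by simp
    qed
  qed
  have mem: "{u, v} \<in> feasible (avoiding (twist {e, f} D) e) \<longleftrightarrow>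
      sym_diff {u, v} {e, f} \<in> feasible D" if "u \<noteq> e" "v \<noteq> e" for u v
    using that mem_twist_iff[of "{u, v}" "{e, f}" D] by simp
  have gr: "ground (avoiding (twist {e, f} D) e) = ground D - {e}" by simp
  have "fundamental_graph_connected (avoiding (twist {e, f} D) e)"
    unfolding fundamental_graph_connected_def gr
  proof (intro allI impI)
    fix V assume V: "V \<subseteq> ground D - {e}" "V \<noteq> {}" "V \<noteq> ground D - {e}"
    show "\<exists>u\<in>V. \<exists>v\<in>ground D - {e} - V. {u, v} \<in> feasible (avoiding (twist {e, f} D) e)"
    proof (cases "f \<in> V")
      case False
      then obtain u v where uv: "u \<in> V" "v \<in> ground D - {e} - V" "sym_diff {u, v} {e, f} \<in> feasible D"
        using key[of V] V by blast
      then have "u \<noteq> e" "v \<noteq> e" using V(1) by blast+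
      then show ?thesis using mem uv by blast
    next
      case True
      then have "ground D - {e} - V \<subseteq> ground D - {e, f}" "ground D - {e} - V \<noteq> {}" using V by blast+
      then obtain u v where uv: "u \<in> ground D - {e} - V" "v \<in> ground D - {e} - (ground D - {e} - V)"
          "sym_diff {u, v} {e, f} \<in> feasible D"
        using key by metis
      then have "u \<noteq> e" "v \<noteq> e" "v \<in> V" by blast+
      moreover from this have "{v, u} \<in> feasible (avoiding (twist {e, f} D) e)"
        using mem[of u v] uv(3) by (simp add: insert_commute)
      ultimately show ?thesis using uv(1) by blast
    qed
  qed
  moreover have "f \<in> ground D" "f \<noteq> e" using f(1) C(1) by blast+
  ultimately show ?thesis using that fe by (simp add: insert_commute)
qed

text \<open>In the recurrence at \<open>e\<close> both summands are non-negative, so one positive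
  summand is enough. It is the deletion if that stays connected, and otherwise the contraction, up
  to a twist, by \<open>pivot_connected\<close>.\<close>

lemma beta_pos:
  assumes "delta_matroid D" "even_dm D" "{} \<in> feasible D" "ground D \<noteq> {}"
    and "fundamental_graph_connected D"
  shows "beta D > 0"
  using assms
proof (induction "card (ground D)" arbitrary: D rule: less_induct)
  case less
  note D = less.prems(1,2)
  obtain e where e: "e \<in> ground D" using less.prems(4) by blast
  show ?case
  proof (cases "ground D = {e}")
    case True
    \<comment> \<open>Evenness forbids \<open>{e}\<close> to be feasible next to \<open>{}\<close>,
      so \<open>e\<close> is a loop and beta is 1.\<close>
    have "e \<notin> F" if F: "F \<in> feasible D" for F
    proof
      assume "e \<in> F"
      then have "F = {e}" using feasible_subset[OF D(1) F] True by blast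
      then show False using F D(2) less.prems(3) unfolding even_dm_def by force
    qed
    then show ?thesis using beta_loop[OF D e] True by simp
  next
    case False
    have sub: "{e} \<subseteq> ground D" using e by blast
    have card: "card (ground D - {e}) < card (ground D)"
      using finite_ground[OF D(1)] e by (rule card_Diff1_less)
    note tw = delta_matroid_twist[OF D(1) sub] even_dm_twist[OF D sub]
    \<comment> \<open>A neighbour of \<open>e\<close> shows that \<open>e\<close> is not a loop, and
      \<open>{}\<close> that it is not a coloop, so the recurrence applies.\<close>
    obtain h where h: "{e, h} \<in> feasible D"
      using less.prems(5) False sub unfolding fundamental_graph_connected_def by blast
    have h': "sym_diff {e, h} {e} \<in> feasible (twist {e} D)" "e \<notin> sym_diff {e, h} {e}"
      using h unfolding mem_twist_iff sym_diff_cancel by blast+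
    have ne: "ground D - {e} \<noteq> {}" using False e by blast
    have rec: "beta D = beta (avoiding D e) + beta (avoiding (twist {e} D) e)"
      using beta_deletion_contraction[OF D(1) e less.prems(3) _ h] by simp
    have av: "delta_matroid (avoiding D e)" "even_dm (avoiding D e)"
      using delta_matroid_avoid[OF D(1) less.prems(3)] even_dm_avoid[OF D(2)] by auto
    have av': "delta_matroid (avoiding (twist {e} D) e)" "even_dm (avoiding (twist {e} D) e)"
      using delta_matroid_avoid[OF tw(1) h'] even_dm_avoid[OF tw(2)] by auto
    show ?thesis
    proof (cases "fundamental_graph_connected (avoiding D e)")
      case True
      then have "beta (avoiding D e) > 0"
        using card av ne less.prems(3) by (intro less.hyps) auto
      then show ?thesis using beta_nonneg[OF av'] rec by simp
    next
      case False
      then obtain C where C: "C \<subseteq> ground D - {e}" "C \<noteq> {}" "C \<noteq> ground D - {e}"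
        and nocut: "\<And>u v. u \<in> C \<Longrightarrow> v \<in> ground D - {e} - C \<Longrightarrow> {u, v} \<notin> feasible (avoiding D e)"
        unfolding fundamental_graph_connected_def fst_conv by blast
      have cut: "{u, v} \<notin> feasible D" if "u \<in> C" "v \<in> ground D - {e} - C" for u v
      proof -
        have "e \<notin> {u, v}" using that C(1) by blast
        then show ?thesis using nocut[OF that] by simp
      qed
      obtain f where f: "f \<in> ground D" "f \<noteq> e" "{e, f} \<in> feasible D"
          and conn: "fundamental_graph_connected (avoiding (twist {e, f} D) e)"
        using pivot_connected[OF D less.prems(5) e C cut] by blast
      have sub2: "{e, f} \<subseteq> ground D" using e f(1) by blast
      \<comment> \<open>Contracting \<open>e\<close> and then twisting by \<open>{f}\<close> amounts
        to pivoting on \<open>e f\<close> and deleting \<open>e\<close>. The pivot makes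
        \<open>{}\<close> feasible, as the induction hypothesis requires.\<close>
      have eq: "twist {f} (avoiding (twist {e} D) e) = avoiding (twist {e, f} D) e"
      proof (rule prod_eqI)
        show "feasible (twist {f} (avoiding (twist {e} D) e)) = feasible (avoiding (twist {e, f} D) e)"
        proof (rule set_eqI)
          fix F
          have "sym_diff (sym_diff F {f}) {e} = sym_diff F {e, f}" using f(2) by blast
          moreover have "e \<in> sym_diff F {f} \<longleftrightarrow> e \<in> F" using f(2) by blast
          ultimately show "F \<in> feasible (twist {f} (avoiding (twist {e} D) e)) \<longleftrightarrow>
              F \<in> feasible (avoiding (twist {e, f} D) e)"
            unfolding mem_twist_iff snd_conv mem_Collect_eq by simp
        qed
      qed simp
      have mem: "{} \<in> feasible (twist {e, f} D)" using f(3) unfolding mem_twist_iff by simp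
      have "beta (avoiding (twist {e, f} D) e) > 0"
        using card ne conn mem delta_matroid_avoid[OF delta_matroid_twist[OF D(1) sub2] mem]
          even_dm_avoid[OF even_dm_twist[OF D sub2]]
        by (intro less.hyps) auto
      moreover have "beta (twist {f} (avoiding (twist {e} D) e)) = beta (avoiding (twist {e} D) e)"
        by (rule beta_twist) (use f in auto)
      ultimately show ?thesis using beta_nonneg[OF av] rec unfolding eq by simp
    qed
  qed
qed

section \<open>Direct sums\<close>

text \<open>For feasible \<open>F\<close> this says that in the fundamental graph of the twist by
  \<open>F\<close> no edge joins \<open>V\<close> to its complement.\<close>

definition no_cross :: "'a set_system \<Rightarrow> 'a set \<Rightarrow> 'a set \<Rightarrow> bool" where
  "no_cross D V F \<longleftrightarrow> (\<forall>u\<in>V. \<forall>v\<in>ground D - V. sym_diff F {u, v} \<notin> feasible D)"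

lemma no_crossD:
  "no_cross D V F \<Longrightarrow> u \<in> V \<Longrightarrow> v \<in> ground D - V \<Longrightarrow> sym_diff F {u, v} \<notin> feasible D"
  unfolding no_cross_def by blast

lemma no_cross_compl:
  assumes "V \<subseteq> ground D"
  shows "no_cross D (ground D - V) F \<longleftrightarrow> no_cross D V F"
proof -
  have eq: "ground D - (ground D - V) = V" using assms by blast
  have "no_cross D (ground D - V) F \<longleftrightarrow> (\<forall>u\<in>ground D - V. \<forall>v\<in>V. sym_diff F {v, u} \<notin> feasible D)"
    unfolding no_cross_def eq by (simp add: insert_commute)
  then show ?thesis unfolding no_cross_def by blast
qed

text \<open>If a crossing pair \<open>u\<close>, \<open>v\<close> appeared, an exchange from
  \<open>F\<close> at \<open>v\<close> would find its partner among \<open>a\<close>,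
  \<open>b\<close>, \<open>u\<close>, all in \<open>V\<close>, and so give a crossing pair already
  at \<open>F\<close>.\<close>

lemma no_cross_step_inside:
  assumes D: "delta_matroid D" "even_dm D" and F: "F \<in> feasible D" "no_cross D V F"
    and ab: "a \<in> V" "b \<in> V" "a \<noteq> b"
  shows "no_cross D V (sym_diff F {a, b})"
  unfolding no_cross_def
proof (intro ballI notI)
  fix u v assume u: "u \<in> V" and v: "v \<in> ground D - V"
    and uv: "sym_diff (sym_diff F {a, b}) {u, v} \<in> feasible D"
  have ne: "v \<noteq> a" "v \<noteq> b" "v \<noteq> u" using u v ab by blast+
  have "v \<in> sym_diff F (sym_diff (sym_diff F {a, b}) {u, v})" using ne by blast
  then obtain x where x: "x \<in> sym_diff F (sym_diff (sym_diff F {a, b}) {u, v})" "x \<noteq> v"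
      "sym_diff F {v, x} \<in> feasible D"
    using exchange[OF D F(1) uv] by blast
  have "x \<in> {a, b, u, v}" using x(1) by blast
  then have "x \<in> V" using x(2) u ab by blast
  then show False using no_crossD[OF F(2) _ v] x(3) by (metis insert_commute)
qed

lemma no_cross_step:
  assumes D: "delta_matroid D" "even_dm D" and V: "V \<subseteq> ground D"
    and F: "F \<in> feasible D" "no_cross D V F"
    and ab: "a \<in> ground D" "b \<in> ground D" "a \<noteq> b" "sym_diff F {a, b} \<in> feasible D"
  shows "no_cross D V (sym_diff F {a, b})"
proof (cases "a \<in> V")
  case True
  then have "b \<in> V" using no_crossD[OF F(2)] ab by blast
  then show ?thesis using no_cross_step_inside[OF D F True] ab(3) by blast
next
  case False
  have "b \<notin> V"
  proof
    assume "b \<in> V"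
    then have "sym_diff F {b, a} \<notin> feasible D" using no_crossD[OF F(2)] False ab(1) by blast
    then show False using ab(4) by (simp add: insert_commute)
  qed
  then have "no_cross D (ground D - V) (sym_diff F {a, b})"
    using False ab F no_cross_step_inside[OF D F(1), of "ground D - V" a b] no_cross_compl[OF V]
    by blast
  then show ?thesis using no_cross_compl[OF V] by blast
qed

text \<open>A cut without edges at one feasible set has none at any other: exchanges lead from
  \<open>F\<close> towards \<open>F0\<close>, and each step preserves the property.\<close>

lemma no_cross_all:
  assumes D: "delta_matroid D" "even_dm D" and V: "V \<subseteq> ground D"
    and F0: "F0 \<in> feasible D" "no_cross D V F0" and "F \<in> feasible D"
  shows "no_cross D V F"
  using assms(6)
proof (induction "card (sym_diff F F0)" arbitrary: F rule: less_induct)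
  case less
  show ?case
  proof (cases "F = F0")
    case True
    then show ?thesis using F0(2) by simp
  next
    case False
    then obtain e where e: "e \<in> sym_diff F F0" by blast
    then obtain x where x: "x \<in> sym_diff F F0" "x \<noteq> e" "sym_diff F {e, x} \<in> feasible D"
      using exchange[OF D less.prems F0(1)] by blast
    have "sym_diff (sym_diff F {e, x}) F0 \<subset> sym_diff F F0" using e x(1) by blast
    moreover have "finite (sym_diff F F0)"
      using finite_feasible[OF D(1)] less.prems F0(1) by blast
    ultimately have "card (sym_diff (sym_diff F {e, x}) F0) < card (sym_diff F F0)"
      by (intro psubset_card_mono)
    then have IH: "no_cross D V (sym_diff F {e, x})" using less.hyps x(3) by blast
    have "e \<in> ground D" "x \<in> ground D"
      using e x(1) feasible_subset[OF D(1)] less.prems F0(1) by blast+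
    \<comment> \<open>Toggling the same pair again undoes the step, so the property returns from the
      nearer set to \<open>F\<close>.\<close>
    then have "no_cross D V (sym_diff (sym_diff F {e, x}) {e, x})"
      using no_cross_step[OF D V x(3) IH, of e x] x(2) less.prems unfolding sym_diff_cancel by blast
    then show ?thesis unfolding sym_diff_cancel .
  qed
qed

text \<open>An exchange from \<open>F2\<close> towards \<open>F1\<close> at an element of
  \<open>V\<close> finds its partner in \<open>V\<close>, as no pair crosses. So the part of
  \<open>F2\<close> inside \<open>V\<close> can be turned into that of \<open>F1\<close> without
  touching the rest.\<close>

lemma no_cross_mix:
  assumes D: "delta_matroid D" "even_dm D"
    and all: "\<And>F. F \<in> feasible D \<Longrightarrow> no_cross D V F"
    and F: "F1 \<in> feasible D" "F2 \<in> feasible D"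
  shows "(F1 \<inter> V) \<union> (F2 - V) \<in> feasible D"
  using F(2)
proof (induction "card (V \<inter> sym_diff F2 F1)" arbitrary: F2 rule: less_induct)
  case less
  show ?case
  proof (cases "V \<inter> sym_diff F2 F1 = {}")
    case True
    then have "(F1 \<inter> V) \<union> (F2 - V) = F2" by blast
    then show ?thesis using less.prems by simp
  next
    case False
    then obtain e where e: "e \<in> V" "e \<in> sym_diff F2 F1" by blast
    then obtain x where x: "x \<in> sym_diff F2 F1" "x \<noteq> e" "sym_diff F2 {e, x} \<in> feasible D"
      using exchange[OF D less.prems F(1)] by blast
    have "x \<in> ground D" using x(1) feasible_subset[OF D(1)] less.prems F(1) by blast
    then have xV: "x \<in> V" using no_crossD[OF all[OF less.prems] e(1)] x(3) by blast
    have "V \<inter> sym_diff (sym_diff F2 {e, x}) F1 \<subset> V \<inter> sym_diff F2 F1" using e x(1) by blast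
    moreover have "finite (V \<inter> sym_diff F2 F1)"
      using finite_feasible[OF D(1)] less.prems F(1) by blast
    ultimately have "card (V \<inter> sym_diff (sym_diff F2 {e, x}) F1) < card (V \<inter> sym_diff F2 F1)"
      by (intro psubset_card_mono)
    then have "(F1 \<inter> V) \<union> (sym_diff F2 {e, x} - V) \<in> feasible D" using less.hyps x(3) by blast
    moreover have "sym_diff F2 {e, x} - V = F2 - V" using e(1) xV by blast
    ultimately show ?thesis by simp
  qed
qed

lemma delta_matroid_trace:
  assumes D: "delta_matroid D" "even_dm D" and V: "V \<subseteq> ground D"
    and all: "\<And>F. F \<in> feasible D \<Longrightarrow> no_cross D V F"
  shows "delta_matroid (V, (\<lambda>F. F \<inter> V) ` feasible D)"
  unfolding delta_matroid_def
proof (intro conjI ballI)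
  show "finite (ground (V, (\<lambda>F. F \<inter> V) ` feasible D))" using finite_subset_ground[OF D(1) V] by simp
  show "feasible (V, (\<lambda>F. F \<inter> V) ` feasible D) \<noteq> {}" using feasible_nonempty[OF D(1)] by simp
  show "feasible (V, (\<lambda>F. F \<inter> V) ` feasible D) \<subseteq> Pow (ground (V, (\<lambda>F. F \<inter> V) ` feasible D))" by auto
next
  fix G1 G2 e
  assume "G1 \<in> feasible (V, (\<lambda>F. F \<inter> V) ` feasible D)" "G2 \<in> feasible (V, (\<lambda>F. F \<inter> V) ` feasible D)"
    and e: "e \<in> sym_diff G1 G2"
  then obtain F1 F2 where F: "F1 \<in> feasible D" "F2 \<in> feasible D" "G1 = F1 \<inter> V" "G2 = F2 \<inter> V" by auto
  have eV: "e \<in> V" "e \<in> sym_diff F1 F2" using e F(3,4) by blast+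
  obtain x where x: "x \<in> sym_diff F1 F2" "x \<noteq> e" "sym_diff F1 {e, x} \<in> feasible D"
    using exchange[OF D F(1,2) eV(2)] by blast
  have "x \<in> ground D" using x(1) feasible_subset[OF D(1)] F(1,2) by blast
  then have xV: "x \<in> V" using no_crossD[OF all[OF F(1)] eV(1)] x(3) by blast
  have "sym_diff G1 {e, x} = sym_diff F1 {e, x} \<inter> V" using F(3) eV(1) xV by blast
  then have "sym_diff G1 {e, x} \<in> feasible (V, (\<lambda>F. F \<inter> V) ` feasible D)"
    using x(3) by simp
  moreover have "x \<in> sym_diff G1 G2" using x(1) xV F(3,4) by blast
  ultimately show "\<exists>f\<in>sym_diff G1 G2. sym_diff G1 {e, f} \<in> feasible (V, (\<lambda>F. F \<inter> V) ` feasible D)"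
    by blast
qed

text \<open>\<open>D\<close> is the direct sum of its traces on \<open>V\<close> and on the
  complement; \<open>no_cross_mix\<close> makes every union of traces feasible.\<close>

lemma no_cross_disconnected:
  assumes D: "delta_matroid D" "even_dm D" and V: "V \<subseteq> ground D" "V \<noteq> {}" "V \<noteq> ground D"
    and F0: "F0 \<in> feasible D" "no_cross D V F0"
  shows "\<not> dm_connected D"
proof -
  let ?V = "ground D - V"
  let ?D1 = "(V, (\<lambda>F. F \<inter> V) ` feasible D)" and ?D2 = "(?V, (\<lambda>F. F \<inter> ?V) ` feasible D)"
  have all: "no_cross D V F" if "F \<in> feasible D" for F using no_cross_all[OF D V(1) F0 that] .
  have all': "no_cross D ?V F" if "F \<in> feasible D" for F
    using all[OF that] no_cross_compl[OF V(1)] by blast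
  have "feasible D = {G1 \<union> G2 |G1 G2. G1 \<in> feasible ?D1 \<and> G2 \<in> feasible ?D2}"
  proof (intro equalityI subsetI)
    fix F assume F: "F \<in> feasible D"
    then have "F = (F \<inter> V) \<union> (F \<inter> ?V)" using feasible_subset[OF D(1)] by blast
    then show "F \<in> {G1 \<union> G2 |G1 G2. G1 \<in> feasible ?D1 \<and> G2 \<in> feasible ?D2}"
      using F unfolding snd_conv by blast
  next
    fix F assume "F \<in> {G1 \<union> G2 |G1 G2. G1 \<in> feasible ?D1 \<and> G2 \<in> feasible ?D2}"
    then obtain F1 F2 where F12: "F1 \<in> feasible D" "F2 \<in> feasible D" "F = (F1 \<inter> V) \<union> (F2 \<inter> ?V)"
      unfolding snd_conv by blast
    have "F2 \<inter> ?V = F2 - V" using feasible_subset[OF D(1) F12(2)] by blast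
    then show "F \<in> feasible D" using no_cross_mix[OF D all F12(1,2)] F12(3) by simp
  qed
  moreover have "ground D = V \<union> ?V" using V(1) by blast
  ultimately have "D = dm_direct_sum ?D1 ?D2" unfolding dm_direct_sum_def by (simp add: prod_eq_iff)
  moreover have "delta_matroid ?D1" using delta_matroid_trace[OF D V(1) all] .
  moreover have "delta_matroid ?D2" using delta_matroid_trace[OF D _ all'] by blast
  moreover have "?V \<noteq> {}" "V \<inter> ?V = {}" using V by blast+
  ultimately show ?thesis unfolding dm_connected_def using V(2) by (metis fst_conv)
qed

text \<open>Twisting by a feasible set makes \<open>{}\<close> feasible. A cut without edges in the
  resulting graph would split \<open>D\<close>.\<close>

lemma beta_pos_of_connected:
  assumes D: "delta_matroid D" "even_dm D" "dm_connected D" "ground D \<noteq> {}"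
  shows "beta D > 0"
proof -
  obtain F where F: "F \<in> feasible D" using feasible_nonempty[OF D(1)] by blast
  have sub: "F \<subseteq> ground D" using feasible_subset[OF D(1) F] .
  have empty: "{} \<in> feasible (twist F D)" using F unfolding mem_twist_iff by simp
  have "fundamental_graph_connected (twist F D)"
    unfolding fundamental_graph_connected_def ground_twist
  proof (intro allI impI)
    fix V assume V: "V \<subseteq> ground D" "V \<noteq> {}" "V \<noteq> ground D"
    then have "\<not> no_cross D V F" using no_cross_disconnected[OF D(1,2) V F] D(3) by blast
    then obtain u v where uv: "u \<in> V" "v \<in> ground D - V" "sym_diff F {u, v} \<in> feasible D"
      unfolding no_cross_def by blast
    have "sym_diff {u, v} F = sym_diff F {u, v}" by blast
    then have "{u, v} \<in> feasible (twist F D)" using uv(3) unfolding mem_twist_iff by simp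
    then show "\<exists>u\<in>V. \<exists>v\<in>ground D - V. {u, v} \<in> feasible (twist F D)" using uv(1,2) by blast
  qed
  then have "beta (twist F D) > 0"
    using beta_pos[OF delta_matroid_twist[OF D(1) sub] even_dm_twist[OF D(1,2) sub] empty] D(4)
    by simp
  then show ?thesis using beta_twist[OF sub] by simp
qed

section \<open>Additivity of d and \<sigma> over direct sums\<close>

lemma fdist_direct_sum:
  assumes "delta_matroid D1" "delta_matroid D2" "ground D1 \<inter> ground D2 = {}"
    and A: "A1 \<subseteq> ground D1" "A2 \<subseteq> ground D2"
  shows "fdist (feasible (dm_direct_sum D1 D2)) (A1 \<union> A2) = fdist (feasible D1) A1 + fdist (feasible D2) A2"
proof -
  have card: "card (sym_diff (A1 \<union> A2) (F1 \<union> F2)) = card (sym_diff A1 F1) + card (sym_diff A2 F2)"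
    if "F1 \<in> feasible D1" "F2 \<in> feasible D2" for F1 F2
  proof -
    have sub: "F1 \<subseteq> ground D1" "F2 \<subseteq> ground D2"
      using that feasible_subset assms(1,2) by metis+
    have "sym_diff (A1 \<union> A2) (F1 \<union> F2) = sym_diff A1 F1 \<union> sym_diff A2 F2"
      using sub A assms(3) by blast
    moreover have "sym_diff A1 F1 \<inter> sym_diff A2 F2 = {}" using sub A assms(3) by blast
    moreover have "finite (sym_diff A1 F1)"
      using A that by (intro finite_subset_ground[OF assms(1)]) (use sub in blast)
    moreover have "finite (sym_diff A2 F2)"
      using A that by (intro finite_subset_ground[OF assms(2)]) (use sub in blast)
    ultimately show ?thesis by (simp only: card_Un_disjoint)
  qed
  obtain F1 where F1: "F1 \<in> feasible D1" "card (sym_diff A1 F1) = fdist (feasible D1) A1"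
    using fdist_attained feasible_nonempty[OF assms(1)] by blast
  obtain F2 where F2: "F2 \<in> feasible D2" "card (sym_diff A2 F2) = fdist (feasible D2) A2"
    using fdist_attained feasible_nonempty[OF assms(2)] by blast
  show ?thesis
  proof (rule fdist_eqI)
    show "F1 \<union> F2 \<in> feasible (dm_direct_sum D1 D2)" using F1(1) F2(1) by (auto simp: dm_direct_sum_def)
    show "card (sym_diff (A1 \<union> A2) (F1 \<union> F2)) = fdist (feasible D1) A1 + fdist (feasible D2) A2"
      using card[OF F1(1) F2(1)] F1(2) F2(2) by simp
    fix F assume "F \<in> feasible (dm_direct_sum D1 D2)"
    then obtain G1 G2 where G: "G1 \<in> feasible D1" "G2 \<in> feasible D2" "F = G1 \<union> G2"
      by (auto simp: dm_direct_sum_def)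
    then show "fdist (feasible D1) A1 + fdist (feasible D2) A2 \<le> card (sym_diff (A1 \<union> A2) F)"
      using card[OF G(1,2)] fdist_le[OF G(1), of A1] fdist_le[OF G(2), of A2] by simp
  qed
qed

lemma even_dm_summands:
  assumes D: "delta_matroid D1" "delta_matroid D2" "ground D1 \<inter> ground D2 = {}"
    and "even_dm (dm_direct_sum D1 D2)"
  shows "even_dm D1" "even_dm D2"
proof -
  have par: "even (card F1 + card F2) \<longleftrightarrow> even (card F1' + card F2')"
    if "F1 \<in> feasible D1" "F2 \<in> feasible D2" "F1' \<in> feasible D1" "F2' \<in> feasible D2" for F1 F2 F1' F2'
  proof -
    have card: "card (G1 \<union> G2) = card G1 + card G2" if "G1 \<in> feasible D1" "G2 \<in> feasible D2" for G1 G2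
    proof (rule card_Un_disjoint)
      show "finite G1" "finite G2" using that finite_feasible D(1,2) by metis+
      have "G1 \<subseteq> ground D1" "G2 \<subseteq> ground D2" using that feasible_subset D(1,2) by metis+
      then show "G1 \<inter> G2 = {}" using D(3) by blast
    qed
    have "F1 \<union> F2 \<in> feasible (dm_direct_sum D1 D2)" "F1' \<union> F2' \<in> feasible (dm_direct_sum D1 D2)"
      using that by (auto simp: dm_direct_sum_def)
    then have "even (card (F1 \<union> F2)) \<longleftrightarrow> even (card (F1' \<union> F2'))"
      using assms(4) unfolding even_dm_def by blast
    then show ?thesis using card that by simp
  qed
  obtain F1 F2 where F: "F1 \<in> feasible D1" "F2 \<in> feasible D2"
    using feasible_nonempty[OF D(1)] feasible_nonempty[OF D(2)] by blast
  have "even (card G) \<longleftrightarrow> even (card G')" if "G \<in> feasible D1" "G' \<in> feasible D1" for G G'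
    using par[OF that(1) F(2) that(2) F(2)] by presburger
  then show "even_dm D1" unfolding even_dm_def by blast
  have "even (card G) \<longleftrightarrow> even (card G')" if "G \<in> feasible D2" "G' \<in> feasible D2" for G G'
    using par[OF F(1) that(1) F(1) that(2)] by presburger
  then show "even_dm D2" unfolding even_dm_def by blast
qed

lemma dm_sigma_direct_sum:
  assumes D: "delta_matroid D1" "delta_matroid D2" "ground D1 \<inter> ground D2 = {}"
    and D12: "delta_matroid (dm_direct_sum D1 D2)" "even_dm (dm_direct_sum D1 D2)"
    and A: "A1 \<subseteq> ground D1" "A2 \<subseteq> ground D2"
  shows "dm_sigma (dm_direct_sum D1 D2) (A1 \<union> A2) = dm_sigma D1 A1 + dm_sigma D2 A2"
proof -
  have "A1 \<union> A2 \<subseteq> ground (dm_direct_sum D1 D2)" using A by (auto simp: dm_direct_sum_def)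
  note s = dm_sigma_fdist[OF D12 this]
  have "finite A1" "finite A2" using A finite_subset_ground D(1,2) by metis+
  moreover have "A1 \<inter> A2 = {}" using A D(3) by blast
  ultimately have "card (A1 \<union> A2) = card A1 + card A2" by (rule card_Un_disjoint)
  moreover note dm_sigma_fdist[OF D(1) even_dm_summands(1)[OF D D12(2)] A(1)]
    dm_sigma_fdist[OF D(2) even_dm_summands(2)[OF D D12(2)] A(2)]
    fdist_direct_sum[OF D A] fdist_direct_sum[OF D, of "{}" "{}"]
  ultimately show ?thesis using s by simp
qed

section \<open>Restriction of bivariate polynomials to the hyperbola\<close>

text \<open>This is (x - 1)^m p(x, x/(x - 1)), provided that m is at least the degree of p in y.\<close>

definition hyper :: "nat \<Rightarrow> 'r::comm_ring_1 poly poly \<Rightarrow> 'r poly" where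
  "hyper m p = (\<Sum>j\<le>m. coeff p j * [:0, 1:] ^ j * [:-1, 1:] ^ (m - j))"

lemma hyper_0 [simp]: "hyper m 0 = 0"
  by (simp add: hyper_def)

lemma hyper_add: "hyper m (p + q) = hyper m p + hyper m q"
  by (simp add: hyper_def distrib_right sum.distrib)

lemma hyper_smult: "hyper m (smult c p) = c * hyper m p"
  by (simp add: hyper_def sum_distrib_left mult.assoc)

lemma hyper_sum: "hyper m (\<Sum>i\<in>I. f i) = (\<Sum>i\<in>I. hyper m (f i))"
  by (induction I rule: infinite_finite_induct) (simp_all add: hyper_add)

text \<open>Horner's rule in y, in the form needed for induction over \<open>pCons\<close>.\<close>

lemma hyper_pCons: "hyper (Suc m) (pCons c p) = c * [:-1, 1:] ^ Suc m + [:0, 1:] * hyper m p"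
proof -
  have "(\<Sum>j\<le>m. coeff p j * [:0, 1:] ^ Suc j * [:-1, 1:] ^ (m - j)) = [:0, 1:] * hyper m p"
    unfolding hyper_def sum_distrib_left by (rule sum.cong) (simp_all only: power_Suc ac_simps)
  then show ?thesis
    unfolding hyper_def[of "Suc m"] sum.atMost_Suc_shift
    by (simp only: coeff_pCons_0 coeff_pCons_Suc power_0 mult_1_right diff_zero diff_Suc_Suc)
qed

lemma hyper_extend:
  assumes "degree p \<le> m"
  shows "hyper (m + k) p = [:-1, 1:] ^ k * hyper m p"
proof -
  have "hyper (m + k) p = (\<Sum>j\<le>m. coeff p j * [:0, 1:] ^ j * [:-1, 1:] ^ (m + k - j))"
    unfolding hyper_def using assms
    by (intro sum.mono_neutral_right) (auto simp: coeff_eq_0)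
  also have "\<dots> = (\<Sum>j\<le>m. [:-1, 1:] ^ k * (coeff p j * [:0, 1:] ^ j * [:-1, 1:] ^ (m - j)))"
  proof (rule sum.cong[OF refl])
    fix j assume "j \<in> {..m}"
    then have "m + k - j = k + (m - j)" by simp
    then show "coeff p j * [:0, 1:] ^ j * [:-1, 1:] ^ (m + k - j) =
        [:-1, 1:] ^ k * (coeff p j * [:0, 1:] ^ j * [:-1, 1:] ^ (m - j))"
      by (simp only: power_add ac_simps)
  qed
  finally show ?thesis unfolding hyper_def by (simp only: sum_distrib_left)
qed

lemma hyper_const: "hyper m [:c:] = [:-1, 1:] ^ m * c"
  using hyper_extend[of "[:c:]" 0 m] by (simp add: hyper_def)

text \<open>Substitution is multiplicative, and the exponents of the scaling factors add.\<close>

lemma hyper_mult: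
  assumes "degree p \<le> m1" "degree q \<le> m2"
  shows "hyper (m1 + m2) (p * q) = hyper m1 p * hyper m2 q"
  using assms(1)
proof (induction p arbitrary: m1)
  case 0
  then show ?case by simp
next
  case (pCons c p)
  have c: "hyper (m + m2) (smult c q) = c * [:-1, 1:] ^ m * hyper m2 q" for m
    using hyper_extend[OF assms(2), of m] by (simp only: hyper_smult ac_simps)
  show ?case
  proof (cases "p = 0")
    case True
    then show ?thesis using c[of m1] hyper_const[of m1 c] by (simp add: mult.commute)
  next
    case False
    then obtain m where m: "m1 = Suc m" "degree p \<le> m" using pCons.prems by (cases m1) auto
    have "hyper (m1 + m2) (pCons c p * q) = hyper (m1 + m2) (smult c q) + hyper (Suc (m + m2)) (pCons 0 (p * q))"
      by (simp add: hyper_add m(1))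
    also have "\<dots> = c * [:-1, 1:] ^ m1 * hyper m2 q + [:0, 1:] * (hyper m p * hyper m2 q)"
      unfolding c hyper_pCons pCons.IH[OF m(2)] by simp
    also have "\<dots> = hyper m1 (pCons c p) * hyper m2 q"
      unfolding m(1) hyper_pCons by (simp only: distrib_right mult.assoc)
    finally show ?thesis .
  qed
qed

text \<open>The point of the hyperbola with x = 0 is the origin.\<close>

lemma poly_hyper_0: "poly (hyper m p) 0 = (-1) ^ m * poly (poly p 0) 0"
proof -
  have "poly (hyper m p) 0 = (\<Sum>j\<le>m. if j = 0 then poly (coeff p 0) 0 * (-1) ^ m else 0)"
    unfolding hyper_def poly_sum by (intro sum.cong) (auto simp: power_0_left)
  then show ?thesis by (simp add: poly_0_coeff_0 mult.commute)
qed

lemma degree_hyper_le: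
  assumes "\<And>j. degree (coeff p j) \<le> \<alpha>"
  shows "degree (hyper m p) \<le> \<alpha> + m"
  unfolding hyper_def
proof (rule degree_sum_le)
  fix j assume j: "j \<in> {..m}"
  have "degree ([:0, 1:] ^ j :: 'a poly) \<le> j" "degree ([:-1, 1:] ^ (m - j) :: 'a poly) \<le> m - j"
    using degree_power_le[of "[:0, 1:] :: 'a poly" j] degree_power_le[of "[:-1, 1:] :: 'a poly" "m - j"]
    by (auto intro: order_trans)
  then show "degree (coeff p j * [:0, 1:] ^ j * [:-1, 1:] ^ (m - j)) \<le> \<alpha> + m"
    using assms[of j] j degree_mult_le[of "coeff p j * [:0, 1:] ^ j" "[:-1, 1:] ^ (m - j)"]
      degree_mult_le[of "coeff p j" "[:0, 1:] ^ j"] by simp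
qed simp

section \<open>Degrees in the inner variable x and the factors of a pure power\<close>

lemma coeff_mult_at_degree_bounds:
  fixes p q :: "'r::comm_semiring_0 poly"
  assumes "degree p \<le> \<alpha>" "degree q \<le> \<beta>"
  shows "coeff (p * q) (\<alpha> + \<beta>) = coeff p \<alpha> * coeff q \<beta>"
proof -
  have "coeff p i * coeff q (\<alpha> + \<beta> - i) = 0" if "i \<le> \<alpha> + \<beta>" "i \<noteq> \<alpha>" for i
  proof (cases "i < \<alpha>")
    case True
    then have "coeff q (\<alpha> + \<beta> - i) = 0" using assms(2) by (intro coeff_eq_0) simp
    then show ?thesis by simp
  next
    case False
    then have "coeff p i = 0" using assms(1) that(2) by (intro coeff_eq_0) simp
    then show ?thesis by simp
  qed
  then have "(\<Sum>i\<le>\<alpha> + \<beta>. coeff p i * coeff q (\<alpha> + \<beta> - i)) = (\<Sum>i\<in>{\<alpha>}. coeff p i * coeff q (\<alpha> + \<beta> - i))"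
    by (intro sum.mono_neutral_right) auto
  then show ?thesis by (simp add: coeff_mult)
qed

text \<open>\<open>\<alpha>\<close> is the degree in x; the \<open>map_poly\<close> term is the
  leading coefficient with respect to x, a polynomial in y.\<close>

lemma inner_degree_obtain:
  fixes p :: "'r::zero poly poly"
  assumes "p \<noteq> 0"
  obtains \<alpha> where "\<And>j. degree (coeff p j) \<le> \<alpha>" "map_poly (\<lambda>c. coeff c \<alpha>) p \<noteq> 0"
proof -
  define \<alpha> where "\<alpha> = Max ((\<lambda>j. degree (coeff p j)) ` {..degree p})"
  have le: "degree (coeff p j) \<le> \<alpha>" for j
  proof (cases "j \<le> degree p")
    case True
    then show ?thesis unfolding \<alpha>_def by (intro Max_ge) auto
  qed (simp add: coeff_eq_0)
  have "\<alpha> \<in> (\<lambda>j. degree (coeff p j)) ` {..degree p}" unfolding \<alpha>_def by (intro Max_in) auto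
  then obtain j where j: "degree (coeff p j) = \<alpha>" by auto
  have "\<exists>i. coeff (coeff p i) \<alpha> \<noteq> 0"
  \<comment> \<open>For \<open>\<alpha> = 0\<close> the maximum may be attained at a zero
    coefficient, so the leading coefficient in y is taken instead.\<close>
  proof (cases "\<alpha> = 0")
    case True
    then have "degree (coeff p (degree p)) = \<alpha>" using le[of "degree p"] by simp
    then show ?thesis using assms by (metis leading_coeff_0_iff)
  next
    case False
    then have "coeff p j \<noteq> 0" using j by auto
    then show ?thesis using j by (metis leading_coeff_0_iff)
  qed
  then obtain i where "coeff (map_poly (\<lambda>c. coeff c \<alpha>) p) i \<noteq> 0" by (auto simp: coeff_map_poly)
  then have "map_poly (\<lambda>c. coeff c \<alpha>) p \<noteq> 0" by auto
  then show ?thesis using le that by blast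
qed

text \<open>Over a domain the leading coefficients with respect to x have a non-zero product, so
  degrees in x add.\<close>

lemma inner_degree_mult_le:
  fixes p q :: "'r::idom poly poly"
  assumes p: "\<And>j. degree (coeff p j) \<le> \<alpha>" "map_poly (\<lambda>c. coeff c \<alpha>) p \<noteq> 0"
    and q: "\<And>j. degree (coeff q j) \<le> \<beta>" "map_poly (\<lambda>c. coeff c \<beta>) q \<noteq> 0"
    and "\<And>j. degree (coeff (p * q) j) \<le> s"
  shows "\<alpha> + \<beta> \<le> s"
proof -
  have "map_poly (\<lambda>c. coeff c (\<alpha> + \<beta>)) (p * q) = map_poly (\<lambda>c. coeff c \<alpha>) p * map_poly (\<lambda>c. coeff c \<beta>) q"
  proof (rule poly_eqI)
    fix n
    have "coeff (coeff (p * q) n) (\<alpha> + \<beta>) = (\<Sum>i\<le>n. coeff (coeff p i) \<alpha> * coeff (coeff q (n - i)) \<beta>)"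
      unfolding coeff_mult[of p q n] coeff_sum coeff_mult_at_degree_bounds[OF p(1) q(1)] ..
    then show "coeff (map_poly (\<lambda>c. coeff c (\<alpha> + \<beta>)) (p * q)) n =
        coeff (map_poly (\<lambda>c. coeff c \<alpha>) p * map_poly (\<lambda>c. coeff c \<beta>) q) n"
      unfolding coeff_mult[of "map_poly (\<lambda>c. coeff c \<alpha>) p"] by (simp add: coeff_map_poly)
  qed
  then have "map_poly (\<lambda>c. coeff c (\<alpha> + \<beta>)) (p * q) \<noteq> 0" using p(2) q(2) by simp
  then obtain j where "coeff (coeff (p * q) j) (\<alpha> + \<beta>) \<noteq> 0"
    by (metis (no_types, lifting) coeff_0 coeff_map_poly poly_eqI)
  then show ?thesis using le_degree assms(5) order_trans by blast
qed

text \<open>\<open>B\<close> does not vanish at 0, so the whole zero of order \<open>s + m\<close>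
  belongs to the restriction of \<open>a\<close>, of degree at most \<alpha> + deg a. As \<alpha> +
  \<beta> \<le> s and deg a + deg b \<le> m, nothing is left for the degrees of
  \<open>b\<close>.\<close>

lemma factor_unit:
  fixes a b :: "'r::idom poly poly"
  assumes deg: "degree (a * b) \<le> m" "\<And>j. degree (coeff (a * b) j) \<le> s"
    and hyp: "hyper m (a * b) = [:0, 1:] ^ (s + m)"
    and b0: "poly (poly b 0) 0 \<noteq> 0"
  shows "b dvd 1"
proof -
  have "a * b \<noteq> 0" using hyp by auto
  then have ne: "a \<noteq> 0" "b \<noteq> 0" by auto
  \<comment> \<open>The slack \<open>k\<close> only contributes a power of x - 1, which does not
    vanish at 0.\<close>
  define k where "k = m - (degree a + degree b)"
  have m: "m = degree a + degree b + k" using deg(1) ne by (simp add: k_def degree_mult_eq)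
  define A where "A = [:-1, 1:] ^ k * hyper (degree a) a"
  define B where "B = hyper (degree b) b"
  have AB: "[:0, 1:] ^ (s + m) = A * B"
  proof -
    have "[:0, 1:] ^ (s + m) = hyper (degree a + degree b + k) (a * b)" using hyp m by simp
    also have "\<dots> = [:-1, 1:] ^ k * (hyper (degree a) a * hyper (degree b) b)"
      using hyper_extend[of "a * b" "degree a + degree b" k] hyper_mult[of a "degree a" b "degree b"]
      by (simp only: degree_mult_le order_refl)
    finally show ?thesis unfolding A_def B_def by (simp only: mult.assoc)
  qed
  obtain \<alpha> where \<alpha>: "\<And>j. degree (coeff a j) \<le> \<alpha>" "map_poly (\<lambda>c. coeff c \<alpha>) a \<noteq> 0"
    using inner_degree_obtain[OF ne(1)] by blast
  obtain \<beta> where \<beta>: "\<And>j. degree (coeff b j) \<le> \<beta>" "map_poly (\<lambda>c. coeff c \<beta>) b \<noteq> 0"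
    using inner_degree_obtain[OF ne(2)] by blast
  have \<alpha>\<beta>: "\<alpha> + \<beta> \<le> s" using inner_degree_mult_le[OF \<alpha> \<beta> deg(2)] .
  have AB0: "A * B \<noteq> 0" unfolding AB[symmetric] by simp
  have "order 0 ([:0, 1:] ^ (s + m) :: 'r poly) = s + m" using order_power_n_n[of "0 :: 'r" "s + m"] by simp
  moreover have "order 0 B = 0" using b0 by (intro order_0I) (simp add: B_def poly_hyper_0)
  moreover have "order 0 ([:-1, 1:] ^ k :: 'r poly) = 0" by (intro order_0I) simp
  ultimately have "order 0 (hyper (degree a) a) = s + m"
    using AB0 order_mult[of A B 0] order_mult[of "[:-1, 1:] ^ k" "hyper (degree a) a" 0]
    unfolding AB by (simp add: A_def)
  moreover have "hyper (degree a) a \<noteq> 0" using AB0 unfolding A_def by auto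
  then have "order 0 (hyper (degree a) a) \<le> \<alpha> + degree a"
    using order_degree degree_hyper_le[OF \<alpha>(1)] le_trans by blast
  ultimately have "degree b = 0" "\<beta> = 0" using \<alpha>\<beta> m by auto
  then obtain b' where "b = [:b':]" "degree b' = 0" using \<beta>(1)[of 0] by (metis coeff_pCons_0 degree_eq_zeroE le_zero_eq)
  then obtain c where c: "b = [:[:c:]:]" by (metis degree_eq_zeroE)
  \<comment> \<open>A constant need not be a unit. Comparing the coefficients of x^(s + m) exhibits
    1 as a multiple of \<open>c\<close>.\<close>
  have "A * B = smult c A" unfolding B_def c by (simp add: hyper_def mult.commute)
  then have "coeff ([:0, 1:] ^ (s + m)) (s + m) = c * coeff A (s + m)" unfolding AB by simp
  moreover have "coeff ([:0, 1:] ^ (s + m) :: 'r poly) (s + m) = 1"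
    using coeff_monom[of "1 :: 'r" "s + m" "s + m"] by (simp add: monom_altdef)
  ultimately have "c dvd 1" by (metis dvd_triv_left)
  then show ?thesis unfolding c by (simp add: is_unit_const_poly_iff)
qed

lemma poly_diagonal_0: "poly (poly p [:0, 1:]) 0 = poly (poly p 0) (0 :: 'r::comm_ring_1)"
  by (induction p) auto

lemma coeff_0_pow: "coeff ([:-1, 1:] ^ e :: 'r::comm_ring_1 poly) 0 = (-1) ^ e"
  by (induction e) auto

lemma coeff_1_pow: "coeff ([:-1, 1:] ^ e :: 'r::comm_ring_1 poly) 1 = (-1) ^ Suc e * of_nat e"
  by (induction e) (auto simp: coeff_0_pow algebra_simps)

section \<open>The Tutte polynomial\<close>

text \<open>All three are Lipschitz inequalities for d. The first two rule out truncation in the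
  exponents, and the third bounds the degree in y.\<close>

lemma dm_sigma_bounds:
  assumes D: "delta_matroid D" "even_dm D" and A: "A \<subseteq> ground D"
  shows "dm_sigma D A \<le> dm_sigma D (ground D)" "dm_sigma D A \<le> card A"
    "card A + dm_sigma D (ground D) \<le> card (ground D) + dm_sigma D A"
proof -
  let ?d = "fdist (feasible D)"
  have "sym_diff A (ground D) = ground D - A" "sym_diff (ground D) A = ground D - A" "sym_diff {} A = A"
    using A by blast+
  then have "?d A \<le> ?d (ground D) + card (ground D - A)" "?d (ground D) \<le> ?d A + card (ground D - A)"
    "?d {} \<le> ?d A + card A"
    using fdist_lipschitz[OF D(1) A subset_refl] fdist_lipschitz[OF D(1) subset_refl A]
      fdist_lipschitz[OF D(1) empty_subsetI A] by simp_all
  moreover have "card (ground D - A) + card A = card (ground D)"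
    using A card_mono[OF finite_ground[OF D(1)] A] finite_subset_ground[OF D(1) A]
    by (simp add: card_Diff_subset)
  moreover note dm_sigma_fdist[OF D A] dm_sigma_fdist[OF D subset_refl]
  ultimately show "dm_sigma D A \<le> dm_sigma D (ground D)" "dm_sigma D A \<le> card A"
    "card A + dm_sigma D (ground D) \<le> card (ground D) + dm_sigma D A" by linarith+
qed

text \<open>A feasible F gives d({}) \<le> |F| and d(E) \<le> |E - F|, hence d({}) + d(E) \<le> |E|.
  The exponent of the sign in \<open>tutte_poly_diagonal\<close> is therefore not truncated.\<close>

lemma fdist_empty_le_dm_sigma:
  assumes D: "delta_matroid D" "even_dm D"
  shows "fdist (feasible D) {} \<le> dm_sigma D (ground D)"
proof -
  obtain F where F: "F \<in> feasible D" using feasible_nonempty[OF D(1)] by blast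
  note sub = feasible_subset[OF D(1) F]
  have eq: "sym_diff {} F = F" "sym_diff (ground D) F = ground D - F" using sub by blast+
  have "card (ground D - F) + card F = card (ground D)"
    using sub card_mono[OF finite_ground[OF D(1)] sub] finite_feasible[OF D(1) F]
    by (simp add: card_Diff_subset)
  then show ?thesis
    using fdist_le[OF F, of "{}"] fdist_le[OF F, of "ground D"] dm_sigma_fdist[OF D subset_refl]
    unfolding eq by linarith
qed

lemma tutte_poly_alt:
  "(tutte_poly D :: 'r::comm_ring_1 poly poly) = (\<Sum>A\<in>Pow (ground D).
     smult ([:-1, 1:] ^ (dm_sigma D (ground D) - dm_sigma D A)) ([:-1, 1:] ^ (card A - dm_sigma D A)))"
proof -
  have "var_x - 1 = ([:[:-1, 1:]:] :: 'r poly poly)" "var_y - 1 = ([:-1, 1:] :: 'r poly poly)"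
    by (simp_all add: var_x_def var_y_def one_pCons)
  moreover have "[:c:] ^ i = [:c ^ i:]" for c :: "'r poly" and i by (induction i) (simp_all add: one_pCons mult.commute)
  ultimately show ?thesis unfolding tutte_poly_def by simp
qed

lemma degree_linear_power: "degree ([:-1, 1:] ^ j :: 'r::comm_ring_1 poly) \<le> j"
  using degree_power_le[of "[:-1, 1:] :: 'r poly" j] by (auto intro: order_trans)

text \<open>On the hyperbola y - 1 is the inverse of x - 1.\<close>

lemma hyper_linear_power: "hyper j ([:-1, 1:] ^ j :: 'r::comm_ring_1 poly poly) = 1"
proof (induction j)
  case (Suc j)
  have "hyper 1 ([:-1, 1:] :: 'r poly poly) = 1"
    by (simp add: hyper_def one_pCons)
  then show ?case
    using hyper_mult[of "[:-1, 1:] :: 'r poly poly" 1 "[:-1, 1:] ^ j" j] degree_linear_power[of j] Suc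
    by simp
qed (simp add: hyper_def)

text \<open>The bounds on the degrees in y and x add up to |E|, exactly the exponent of the power of
  x. This is the tightness that \<open>factor_unit\<close> exploits.\<close>

lemma tutte_poly_hyper:
  assumes D: "delta_matroid D" "even_dm D"
  shows "degree (tutte_poly D :: 'r::comm_ring_1 poly poly) \<le> card (ground D) - dm_sigma D (ground D)"
    "degree (coeff (tutte_poly D :: 'r poly poly) j) \<le> dm_sigma D (ground D)"
    "hyper (card (ground D) - dm_sigma D (ground D)) (tutte_poly D :: 'r poly poly) = [:0, 1:] ^ card (ground D)"
proof -
  let ?E = "ground D"
  let ?s = "dm_sigma D ?E"
  let ?v = "[:-1, 1:] :: 'r poly"
  let ?t = "\<lambda>A. smult (?v ^ (?s - dm_sigma D A)) ([:-1, 1:] ^ (card A - dm_sigma D A)) :: 'r poly poly"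
  have b: "dm_sigma D A \<le> ?s" "dm_sigma D A \<le> card A" "card A + ?s \<le> card ?E + dm_sigma D A"
    if "A \<in> Pow ?E" for A
    using dm_sigma_bounds[OF D, of A] that by auto
  have deg: "degree (?t A) \<le> card A - dm_sigma D A" for A
    using degree_smult_le degree_linear_power le_trans by blast
  show "degree (tutte_poly D :: 'r poly poly) \<le> card ?E - ?s"
    unfolding tutte_poly_alt
  proof (rule degree_sum_le)
    show "finite (Pow ?E)" using finite_ground[OF D(1)] by simp
    fix A assume "A \<in> Pow ?E"
    then show "degree (?t A) \<le> card ?E - ?s" using b[of A] deg[of A] by linarith
  qed
  \<comment> \<open>Powers of y - 1 have coefficients free of x, so the degree in x of a summand
    comes from its scalar factor alone.\<close>
  have const: "\<exists>c. coeff ([:-1, 1:] ^ i :: 'r poly poly) j = [:c:]" for i j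
  proof (induction i arbitrary: j)
    case 0
    have "coeff (1 :: 'r poly poly) j = [:if j = 0 then 1 else 0:]" by (cases j) (simp_all add: one_pCons)
    then show ?case unfolding power_0 by blast
  next
    case (Suc i)
    obtain c where c: "coeff ([:-1, 1:] ^ i :: 'r poly poly) j = [:c:]" using Suc by blast
    show ?case
    proof (cases j)
      case 0
      then have "coeff ([:-1, 1:] ^ Suc i :: 'r poly poly) j = [:- c:]" using c by simp
      then show ?thesis by blast
    next
      case (Suc j')
      obtain c' where "coeff ([:-1, 1:] ^ i :: 'r poly poly) j' = [:c':]" using Suc.IH by blast
      then have "coeff ([:-1, 1:] ^ Suc i :: 'r poly poly) j = [:c' - c:]" using c Suc by simp
      then show ?thesis by blast
    qed
  qed
  have deg0: "degree (coeff ([:-1, 1:] ^ i :: 'r poly poly) j) = 0" for i j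
  proof -
    obtain c where "coeff ([:-1, 1:] ^ i :: 'r poly poly) j = [:c:]" using const by blast
    then show ?thesis by simp
  qed
  show "degree (coeff (tutte_poly D :: 'r poly poly) j) \<le> ?s"
    unfolding tutte_poly_alt coeff_sum
  proof (rule degree_sum_le)
    show "finite (Pow ?E)" using finite_ground[OF D(1)] by simp
    fix A assume "A \<in> Pow ?E"
    have "degree (coeff (?t A) j) \<le> ?s - dm_sigma D A"
      unfolding coeff_smult
      using degree_mult_le[of "?v ^ (?s - dm_sigma D A)" "coeff ([:-1, 1:] ^ (card A - dm_sigma D A)) j"]
        degree_linear_power[of "?s - dm_sigma D A", where 'r = 'r] unfolding deg0 by linarith
    then show "degree (coeff (?t A) j) \<le> ?s" by linarith
  qed
  \<comment> \<open>With the scaling included, the exponent of x - 1 is (\<sigma>(E) - \<sigma>(A))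
    - (|A| - \<sigma>(A)) + (|E| - \<sigma>(E)) = |E| - |A|, so \<sigma> drops out.\<close>
  have summand: "hyper (card ?E - ?s) (?t A) = ?v ^ card (?E - A)" if A: "A \<in> Pow ?E" for A
  proof -
    let ?j = "card A - dm_sigma D A"
    let ?k = "card ?E - ?s - ?j"
    have eq: "?j + ?k = card ?E - ?s" "?s - dm_sigma D A + ?k = card ?E - card A"
      using b[OF A] by linarith+
    have "hyper (?j + ?k) (?t A) = ?v ^ (?s - dm_sigma D A) * ?v ^ ?k"
      unfolding hyper_smult hyper_extend[OF degree_linear_power] hyper_linear_power by simp
    also have "\<dots> = ?v ^ (card ?E - card A)" by (simp only: power_add[symmetric] eq)
    also have "card ?E - card A = card (?E - A)"
      using A finite_subset_ground[OF D(1)] by (simp add: card_Diff_subset)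
    finally show ?thesis unfolding eq .
  qed
  have "hyper (card ?E - ?s) (tutte_poly D) = (\<Sum>A\<in>Pow ?E. ?v ^ card (?E - A))"
    unfolding tutte_poly_alt hyper_sum using summand by (intro sum.cong) auto
  also have "\<dots> = (\<Prod>x\<in>?E. 1 + ?v)"
    using prod_add[OF finite_ground[OF D(1)], of "\<lambda>_. 1" "\<lambda>_. ?v"] by simp
  also have "\<dots> = [:0, 1:] ^ card ?E" by (simp add: one_pCons)
  finally show "hyper (card ?E - ?s) (tutte_poly D :: 'r poly poly) = [:0, 1:] ^ card ?E" .
qed

lemma tutte_poly_diagonal:
  assumes D: "delta_matroid D" "even_dm D" "ground D \<noteq> {}"
  shows "coeff (poly (tutte_poly D :: 'r::comm_ring_1 poly poly) [:0, 1:]) 1 =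
    (-1) ^ (dm_sigma D (ground D) - fdist (feasible D) {}) * of_int (beta D)"
proof -
  let ?s = "dm_sigma D (ground D)"
  let ?d = "fdist (feasible D)"
  let ?K = "?s - ?d {}"
  let ?v = "[:-1, 1:] :: 'r poly"
  \<comment> \<open>On the diagonal the exponents add to \<sigma>(E) + |A| - 2 \<sigma>(A), which is
    \<sigma>(E) - d({}) + d(A).\<close>
  have exp: "?s - dm_sigma D A + (card A - dm_sigma D A) = ?K + ?d A" if "A \<in> Pow (ground D)" for A
    using dm_sigma_bounds[OF D(1,2), of A] dm_sigma_fdist[OF D(1,2), of A]
      fdist_empty_le_dm_sigma[OF D(1,2)] that by simp
  have lin: "poly ([:-1, 1:] ^ j) [:0, 1:] = ?v ^ j" for j
    by (simp add: one_pCons)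
  have "poly (tutte_poly D) [:0, 1:] = (\<Sum>A\<in>Pow (ground D). ?v ^ (?K + ?d A))"
    unfolding tutte_poly_alt poly_sum poly_smult lin power_add[symmetric]
    using exp by (intro sum.cong) auto
  then have "coeff (poly (tutte_poly D :: 'r poly poly) [:0, 1:]) 1 =
      (\<Sum>A\<in>Pow (ground D). (-1) ^ Suc (?K + ?d A) * of_nat (?K + ?d A))"
    by (simp only: coeff_sum coeff_1_pow)
  \<comment> \<open>The part d(A) of the exponent yields beta; the constant part \<open>?K\<close>
    multiplies an alternating sum that vanishes.\<close>
  also have "\<dots> = (\<Sum>A\<in>Pow (ground D). (-1) ^ ?K * of_int ((-1) ^ Suc (?d A) * int (?d A))
      - (-1) ^ ?K * of_nat ?K * (-1) ^ ?d A)"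
    by (intro sum.cong) (simp_all add: power_add algebra_simps)
  also have "\<dots> = (-1) ^ ?K * of_int (beta D)
      - (-1) ^ ?K * of_nat ?K * (\<Sum>A\<in>Pow (ground D). (-1) ^ ?d A)"
    unfolding beta_def of_int_sum by (simp only: sum_subtractf sum_distrib_left)
  finally show ?thesis using sum_fdist_alternating[OF D(1,2) subset_refl D(3), where 'b = 'r] by simp
qed

text \<open>The polynomial vanishes at the origin, because its restriction to the hyperbola is a
  positive power of x.\<close>

lemma tutte_poly_not_unit:
  assumes D: "delta_matroid D" "even_dm D" "ground D \<noteq> {}"
  shows "\<not> (tutte_poly D :: 'r::idom poly poly) dvd 1"
proof
  assume "(tutte_poly D :: 'r poly poly) dvd 1"
  then obtain q where "1 = (tutte_poly D :: 'r poly poly) * q" by (rule dvdE)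
  then have "poly (poly 1 0) 0 = poly (poly (tutte_poly D :: 'r poly poly) 0) 0 * poly (poly q 0) 0"
    by (metis poly_mult)
  moreover have "card (ground D) \<noteq> 0" using D(3) finite_ground[OF D(1)] by simp
  then have "poly (poly (tutte_poly D :: 'r poly poly) 0) 0 = 0"
    using arg_cong[OF tutte_poly_hyper(3)[OF D(1,2)], of "\<lambda>p. poly p (0 :: 'r)"] by (simp add: poly_hyper_0 power_0_left)
  ultimately show False by simp
qed

lemma tutte_poly_direct_sum:
  assumes D: "delta_matroid D1" "delta_matroid D2" "ground D1 \<inter> ground D2 = {}"
    and D12: "delta_matroid (dm_direct_sum D1 D2)" "even_dm (dm_direct_sum D1 D2)"
  shows "tutte_poly (dm_direct_sum D1 D2) = tutte_poly D1 * (tutte_poly D2 :: 'r::comm_ring_1 poly poly)"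
proof -
  let ?D = "dm_direct_sum D1 D2"
  let ?x = "var_x - 1 :: 'r poly poly" and ?y = "var_y - 1 :: 'r poly poly"
  let ?t = "\<lambda>D A. ?x ^ (dm_sigma D (ground D) - dm_sigma D A) * ?y ^ (card A - dm_sigma D A)"
  have gr: "ground ?D = ground D1 \<union> ground D2" by (simp add: dm_direct_sum_def)
  note ev = even_dm_summands[OF D D12(2)]
  have "bij_betw (\<lambda>(A1, A2). A1 \<union> A2) (Pow (ground D1) \<times> Pow (ground D2)) (Pow (ground ?D))"
    by (rule bij_betw_byWitness[where f' = "\<lambda>A. (A \<inter> ground D1, A \<inter> ground D2)"])
      (use D(3) in \<open>auto simp: gr\<close>)
  then have "tutte_poly ?D = (\<Sum>(A1, A2)\<in>Pow (ground D1) \<times> Pow (ground D2). ?t ?D (A1 \<union> A2))"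
    unfolding tutte_poly_def by (subst sum.reindex_bij_betw[symmetric]) (auto simp: case_prod_unfold)
  also have "\<dots> = (\<Sum>(A1, A2)\<in>Pow (ground D1) \<times> Pow (ground D2). ?t D1 A1 * ?t D2 A2)"
  proof (rule sum.cong[OF refl], clarify)
    fix A1 A2 assume A: "A1 \<subseteq> ground D1" "A2 \<subseteq> ground D2"
    have "card (A1 \<union> A2) = card A1 + card A2"
      using A D finite_subset_ground[OF D(1)] finite_subset_ground[OF D(2)]
      by (intro card_Un_disjoint) auto
    then have 1: "card (A1 \<union> A2) - dm_sigma ?D (A1 \<union> A2)
        = (card A1 - dm_sigma D1 A1) + (card A2 - dm_sigma D2 A2)"
      using dm_sigma_direct_sum[OF D D12 A] dm_sigma_bounds(2)[OF D(1) ev(1) A(1)]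
        dm_sigma_bounds(2)[OF D(2) ev(2) A(2)] by simp
    have 2: "dm_sigma ?D (ground ?D) - dm_sigma ?D (A1 \<union> A2)
        = (dm_sigma D1 (ground D1) - dm_sigma D1 A1) + (dm_sigma D2 (ground D2) - dm_sigma D2 A2)"
      unfolding gr dm_sigma_direct_sum[OF D D12 A] dm_sigma_direct_sum[OF D D12 subset_refl subset_refl]
      using dm_sigma_bounds(1)[OF D(1) ev(1) A(1)] dm_sigma_bounds(1)[OF D(2) ev(2) A(2)] by simp
    show "?t ?D (A1 \<union> A2) = ?t D1 A1 * ?t D2 A2"
      unfolding 1 2 by (simp only: power_add ac_simps)
  qed
  also have "\<dots> = tutte_poly D1 * tutte_poly D2"
    unfolding tutte_poly_def sum_product sum.cartesian_product ..
  finally show ?thesis .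
qed

text \<open>Characteristic zero keeps the positive integer beta non-zero in the coefficient ring,
  which covers the integers and the complex numbers at once.\<close>

theorem tutte_poly_irreducible_iff_connected:
  assumes D: "delta_matroid D" "even_dm D"
  shows "no_nontrivial_factorization (tutte_poly D :: 'r::{idom, ring_char_0} poly poly) \<longleftrightarrow> dm_connected D"
proof
  assume irr: "no_nontrivial_factorization (tutte_poly D :: 'r poly poly)"
  show "dm_connected D"
  proof (rule ccontr)
    assume "\<not> dm_connected D"
    then obtain D1 D2 where D12: "delta_matroid D1" "delta_matroid D2" "ground D1 \<noteq> {}" "ground D2 \<noteq> {}"
      "ground D1 \<inter> ground D2 = {}" "D = dm_direct_sum D1 D2" unfolding dm_connected_def by blast
    note dm = D[unfolded D12(6)]
    note ev = even_dm_summands[OF D12(1,2,5) dm(2)]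
    have "tutte_poly D = tutte_poly D1 * (tutte_poly D2 :: 'r poly poly)"
      unfolding D12(6) by (rule tutte_poly_direct_sum[OF D12(1,2,5) dm])
    then show False
      using irr tutte_poly_not_unit[OF D12(1) ev(1) D12(3), where 'r = 'r]
        tutte_poly_not_unit[OF D12(2) ev(2) D12(4), where 'r = 'r]
      unfolding no_nontrivial_factorization_def by blast
  qed
next
  assume conn: "dm_connected D"
  have "a dvd 1 \<or> b dvd 1" if T: "tutte_poly D = a * b" for a b :: "'r poly poly"
  proof (cases "ground D = {}")
    case True
    then have "tutte_poly D = (1 :: 'r poly poly)" by (simp add: tutte_poly_def)
    then show ?thesis using T by (metis dvd_triv_left)
  next
    case False
    let ?s = "dm_sigma D (ground D)"
    let ?m = "card (ground D) - ?s"
    have "?s + ?m = card (ground D)" using dm_sigma_bounds(2)[OF D subset_refl] by simp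
    then have hyp: "degree (a * b) \<le> ?m" "degree (coeff (a * b) j) \<le> ?s" "hyper ?m (a * b) = [:0, 1:] ^ (?s + ?m)" for j
      using tutte_poly_hyper[OF D, where 'r = 'r] unfolding T by simp_all
    then have hyp': "degree (b * a) \<le> ?m" "degree (coeff (b * a) j) \<le> ?s" "hyper ?m (b * a) = [:0, 1:] ^ (?s + ?m)" for j
      by (simp_all only: mult.commute[of b a])
    let ?a = "poly a [:0, 1:]" and ?b = "poly b [:0, 1:]"
    have "coeff (poly (tutte_poly D :: 'r poly poly) [:0, 1:]) 1 \<noteq> 0"
      using beta_pos_of_connected[OF D conn False] unfolding tutte_poly_diagonal[OF D False] by simp
    \<comment> \<open>If \<open>a\<close> and \<open>b\<close> both vanished at the origin, their
      product on the diagonal would have no linear term.\<close>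
    moreover have "coeff (poly (tutte_poly D) [:0, 1:]) 1 = coeff ?a 0 * coeff ?b 1 + coeff ?a 1 * coeff ?b 0"
      unfolding T poly_mult by (simp add: coeff_mult)
    ultimately have "poly ?a 0 \<noteq> 0 \<or> poly ?b 0 \<noteq> 0" by (auto simp: poly_0_coeff_0)
    then show ?thesis
      unfolding poly_diagonal_0 using factor_unit[OF hyp] factor_unit[OF hyp'] by blast
  qed
  then show "no_nontrivial_factorization (tutte_poly D :: 'r poly poly)"
    unfolding no_nontrivial_factorization_def by blast
qed

theorem theorem1p2:
  fixes D :: "'a set_system"
  assumes "delta_matroid D" and "even_dm D"
  shows "(no_nontrivial_factorization (tutte_poly D :: int poly poly) \<longleftrightarrow> dm_connected D) \<and>
         (no_nontrivial_factorization (tutte_poly D :: complex poly poly) \<longleftrightarrow> dm_connected D)"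
  by (intro conjI tutte_poly_irreducible_iff_connected[OF assms])

end
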